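(* Let $J\ge2$, let $\mu$ be counting measure on $\mathbb Z$, and let the data $X=(X_n)_{n\le N}$ come from the $J$-state hidden Markov model described in the context, with parameters satisfying Assumptions A2' and A3. Let $M_N$ be any sequence tending to infinity. Then there exist estimators $\hat f_1,\dots,\hat f_J$ (functions of $X$) and a permutation $\tau$ of $\{1,\dots,J\}$ such that for each $j\le J$, $$\Pi_H\big(\|\hat f_j-f_{\tau(j)}\|_\infty\ge M_NN^{-1/2}\big)\to0\quad\text{as }N\to\infty.$$
   Context: $J$-state hidden Markov model: $\theta=(\theta_n)_{n\le N}$ is a Markov chain on $\{1,\dots,J\}$ with transition matrix $Q$ ($J\times J$) and initial distribution $\pi$; conditionally on $\theta$, $X_1,\dots,X_N$ are independent and $X_n$ has density $f_{\theta_n}$ with respect to $\mu$ (the emission densities $f_1,\dots,f_J$). $\Pi_H$ denotes the law for $H=(Q,\pi,f_1,\dots,f_J)$; $\|\cdot\|_\infty$ is the supremum norm. Assumption A2': $Q$ has full rank, the chain is irreducible and aperiodic, and $\theta_1$ follows the invariant distribution $\pi$. Assumption A3: $f_1,\dots,f_J$ are linearly independent. *)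

theory Defs
  imports "HOL-Analysis.Analysis" "HOL-Combinatorics.Permutations"
begin

(* States are 0..J-1; observations are integers (mu = counting measure on Z). *)

definition stoch_matrix :: "nat \<Rightarrow> (nat \<Rightarrow> nat \<Rightarrow> real) \<Rightarrow> bool" where
  "stoch_matrix J Q \<longleftrightarrow> (\<forall>i<J. \<forall>k<J. Q i k \<ge> 0) \<and> (\<forall>i<J. (\<Sum>k<J. Q i k) = 1)"

definition prob_vec :: "nat \<Rightarrow> (nat \<Rightarrow> real) \<Rightarrow> bool" where
  "prob_vec J p \<longleftrightarrow> (\<forall>i<J. p i \<ge> 0) \<and> (\<Sum>i<J. p i) = 1"

definition invariant_dist :: "nat \<Rightarrow> (nat \<Rightarrow> nat \<Rightarrow> real) \<Rightarrow> (nat \<Rightarrow> real) \<Rightarrow> bool" where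
  "invariant_dist J Q p \<longleftrightarrow> prob_vec J p \<and> (\<forall>k<J. (\<Sum>i<J. p i * Q i k) = p k)"

fun mpow :: "nat \<Rightarrow> (nat \<Rightarrow> nat \<Rightarrow> real) \<Rightarrow> nat \<Rightarrow> nat \<Rightarrow> nat \<Rightarrow> real" where
  "mpow J Q 0 = (\<lambda>i k. if i = k then 1 else 0)"
| "mpow J Q (Suc n) = (\<lambda>i k. \<Sum>l<J. mpow J Q n i l * Q l k)"

definition irreducible_chain :: "nat \<Rightarrow> (nat \<Rightarrow> nat \<Rightarrow> real) \<Rightarrow> bool" where
  "irreducible_chain J Q \<longleftrightarrow> (\<forall>i<J. \<forall>k<J. \<exists>n>0. mpow J Q n i k > 0)"

definition aperiodic_chain :: "nat \<Rightarrow> (nat \<Rightarrow> nat \<Rightarrow> real) \<Rightarrow> bool" where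
  "aperiodic_chain J Q \<longleftrightarrow> (\<forall>i<J. Gcd {n. n > 0 \<and> mpow J Q n i i > 0} = 1)"

definition full_rank :: "nat \<Rightarrow> (nat \<Rightarrow> nat \<Rightarrow> real) \<Rightarrow> bool" where
  "full_rank J Q \<longleftrightarrow> (\<forall>c. (\<forall>k<J. (\<Sum>i<J. c i * Q i k) = 0) \<longrightarrow> (\<forall>i<J. c i = 0))"

definition emission_pmfs :: "nat \<Rightarrow> (nat \<Rightarrow> int \<Rightarrow> real) \<Rightarrow> bool" where
  "emission_pmfs J f \<longleftrightarrow> (\<forall>j<J. (\<forall>x. f j x \<ge> 0) \<and> (f j has_sum 1) UNIV)"

definition lin_indep_fun :: "nat \<Rightarrow> (nat \<Rightarrow> int \<Rightarrow> real) \<Rightarrow> bool" where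
  "lin_indep_fun J f \<longleftrightarrow> (\<forall>c. (\<forall>x. (\<Sum>j<J. c j * f j x) = 0) \<longrightarrow> (\<forall>j<J. c j = 0))"

definition A2' :: "nat \<Rightarrow> (nat \<Rightarrow> nat \<Rightarrow> real) \<Rightarrow> (nat \<Rightarrow> real) \<Rightarrow> bool" where
  "A2' J Q p \<longleftrightarrow> stoch_matrix J Q \<and> full_rank J Q \<and> irreducible_chain J Q
     \<and> aperiodic_chain J Q \<and> invariant_dist J Q p"

definition A3 :: "nat \<Rightarrow> (nat \<Rightarrow> int \<Rightarrow> real) \<Rightarrow> bool" where
  "A3 J f \<longleftrightarrow> emission_pmfs J f \<and> lin_indep_fun J f"

definition hmm_prob :: "nat \<Rightarrow> (nat \<Rightarrow> nat \<Rightarrow> real) \<Rightarrow> (nat \<Rightarrow> real) \<Rightarrow> (nat \<Rightarrow> int \<Rightarrow> real)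
    \<Rightarrow> int list \<Rightarrow> real" where
  "hmm_prob J Q p f xs =
     (if xs = [] then 1 else
      (\<Sum>\<theta>\<in>{\<theta>::nat list. length \<theta> = length xs \<and> set \<theta> \<subseteq> {..<J}}.
         p (\<theta> ! 0) * (\<Prod>n<length xs - 1. Q (\<theta> ! n) (\<theta> ! Suc n))
         * (\<Prod>n<length xs. f (\<theta> ! n) (xs ! n))))"

definition hmm_P :: "nat \<Rightarrow> (nat \<Rightarrow> nat \<Rightarrow> real) \<Rightarrow> (nat \<Rightarrow> real) \<Rightarrow> (nat \<Rightarrow> int \<Rightarrow> real)
    \<Rightarrow> nat \<Rightarrow> (int list \<Rightarrow> bool) \<Rightarrow> real" where
  "hmm_P J Q p f N A = infsum (hmm_prob J Q p f) {xs. length xs = N \<and> A xs}"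

definition sup_norm :: "(int \<Rightarrow> real) \<Rightarrow> ereal" where
  "sup_norm g = (SUP x. ereal \<bar>g x\<bar>)"

end

theory Submission
  imports Defs "HOL-Probability.Probability" "HOL-Real_Asymp.Real_Asymp"
begin

text \<open>Let \<open>T(x, y, z)\<close> be the law of three consecutive observations and \<open>T(x, z)\<close> that of the outer two.
  Cylinder frequencies of an irreducible chain have variance at most a constant times (probability)/\<open>N\<close>;
  since the probabilities of all points add up to 1, a union bound over the infinitely many points still
  shows that the empirical versions of both laws are uniformly within \<open>r\<^sub>N\<close> of the truth, for
  any \<open>r\<^sub>N\<close> of larger order than \<open>N\<^sup>-\<^sup>1\<^sup>/\<^sup>2\<close>. The estimator picks any admissible parameter whose laws are
  within \<open>r\<^sub>N\<close> of the empirical ones, so it suffices that the inverse of the parameter-to-law map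
  is Lipschitz at the true parameter.
  Contracting \<open>x\<close> and \<open>z\<close> with finitely supported functionals dual to the true
  parameter turns the law of a nearby parameter into matrices \<open>U diag(f'(y)) V\<^sup>T\<close> close to
  \<open>diag(f(y))\<close>, uniformly in \<open>y\<close>, with \<open>U V\<^sup>T\<close> close to the identity. Hence each \<open>f'\<^sub>j\<close> is
  close to some \<open>f\<^sub>i\<close>, and boundedness of \<open>U\<close> and \<open>V\<close> forces every \<open>i\<close> to occur.
  Requiring the estimates to be sorted lexicographically, up to a tolerance, makes the permutation independent of \<open>N\<close>.\<close>

section \<open>Linear algebra\<close>

text \<open>Gaussian elimination: a nonzero entry of row \<open>a\<close> in column \<open>l\<close>
  serves as pivot, the induction hypothesis solves the reduced system in the unknowns
  \<open>K - {l}\<close>, and row \<open>a\<close> then determines the value at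
  \<open>l\<close>.\<close>

lemma homogeneous_system_nontrivial:
  fixes M :: "'a \<Rightarrow> 'b \<Rightarrow> real"
  assumes "finite A" "finite K" "card A < card K"
  shows "\<exists>w. (\<exists>k\<in>K. w k \<noteq> 0) \<and> (\<forall>j\<in>A. (\<Sum>k\<in>K. M j k * w k) = 0)"
  using assms
proof (induction A arbitrary: K M rule: finite_induct)
  case empty
  then have "K \<noteq> {}" by auto
  then show ?case by (intro exI[of _ "\<lambda>_. 1"]) auto
next
  case (insert a A)
  show ?case
  proof (cases "\<forall>k\<in>K. M a k = 0")
    case True
    then show ?thesis using insert.IH[of K M] insert.prems insert.hyps by auto
  next
    case False
    then obtain l where l: "l \<in> K" "M a l \<noteq> 0" by blast
    define K' where "K' = K - {l}"
    have K: "K = insert l K'" "l \<notin> K'" "finite K'" using l insert.prems by (auto simp: K'_def)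
    have "card A < card K'" using insert.prems insert.hyps K by auto
    then obtain w where w: "\<exists>k\<in>K'. w k \<noteq> 0"
      "\<forall>j\<in>A. (\<Sum>k\<in>K'. (M j k - M j l * M a k / M a l) * w k) = 0"
      using insert.IH[of K' "\<lambda>j k. M j k - M j l * M a k / M a l"] K by blast
    define s where "s = - (\<Sum>k\<in>K'. M a k * w k) / M a l"
    define u where "u = w(l := s)"
    have sum_u: "(\<Sum>k\<in>K. M j k * u k) = M j l * s + (\<Sum>k\<in>K'. M j k * w k)" for j
      using K by (auto simp: u_def intro!: sum.cong)
    have "(\<Sum>k\<in>K. M a k * u k) = 0" using l by (simp add: sum_u s_def)
    moreover have "(\<Sum>k\<in>K. M j k * u k) = 0" if "j \<in> A" for j
    proof -
      have "0 = (\<Sum>k\<in>K'. M j k * w k) - M j l / M a l * (\<Sum>k\<in>K'. M a k * w k)"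
        using w(2) that by (simp add: algebra_simps sum_subtractf sum_distrib_left)
      then show ?thesis unfolding sum_u s_def by simp
    qed
    moreover have "\<exists>k\<in>K. u k \<noteq> 0" using w(1) K by (auto simp: u_def)
    ultimately show ?thesis by (intro exI[of _ u]) auto
  qed
qed

text \<open>Functionals biorthogonal to independent functions, built one function at a time as in
  Gram-Schmidt. Their finite support matters: contracting with them multiplies a uniform error by at
  most a finite l1 norm.\<close>

lemma dual_functionals:
  fixes g :: "nat \<Rightarrow> 'a \<Rightarrow> real"
  assumes "\<And>c. \<forall>x\<in>X. (\<Sum>j<n. c j * g j x) = 0 \<Longrightarrow> \<forall>j<n. c j = 0"
  shows "\<exists>S v. finite S \<and> S \<subseteq> X \<and> (\<forall>i<n. \<forall>j<n. (\<Sum>x\<in>S. v i x * g j x) = (if i = j then 1 else 0))"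
  using assms
proof (induction n)
  case 0
  then show ?case by (intro exI[of _ "{}"]) auto
next
  case (Suc n)
  have "\<forall>j<n. c j = 0" if "\<forall>x\<in>X. (\<Sum>j<n. c j * g j x) = 0" for c
  proof -
    have "(\<Sum>j<Suc n. (c(n := 0)) j * g j x) = (\<Sum>j<n. c j * g j x)" for x by simp
    with Suc.prems[of "c(n := 0)"] that have "\<forall>j<Suc n. (c(n := 0)) j = 0" by simp
    then show ?thesis by (metis fun_upd_other less_SucI nat_neq_iff)
  qed
  from Suc.IH[OF this] obtain S v where S: "finite S" "S \<subseteq> X"
    and v: "\<And>i j. i < n \<Longrightarrow> j < n \<Longrightarrow> (\<Sum>x\<in>S. v i x * g j x) = (if i = j then 1 else 0)"
    by blast
  define b where "b i = (\<Sum>x\<in>S. v i x * g n x)" for i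
  \<comment> \<open>The residual of \<open>g n\<close> after subtracting its components
    \<open>b i\<close> along the earlier functions cannot vanish on all of \<open>X\<close>, since
    that would be a relation with coefficient 1 at \<open>n\<close>.\<close>
  have "\<exists>x0\<in>X. g n x0 - (\<Sum>i<n. b i * g i x0) \<noteq> 0"
  proof (rule ccontr)
    assume "\<not> ?thesis"
    then have "\<forall>x\<in>X. (\<Sum>j<Suc n. (if j = n then 1 else - b j) * g j x) = 0"
      by (simp add: sum_negf)
    from Suc.prems[OF this] show False by auto
  qed
  then obtain x0 where x0: "x0 \<in> X" and h0: "g n x0 - (\<Sum>i<n. b i * g i x0) \<noteq> 0" by blast
  define h where "h = g n x0 - (\<Sum>i<n. b i * g i x0)"
  define S' where "S' = insert x0 S"
  define v' where "v' i x = (if x \<in> S then v i x else 0)" for i x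
  \<comment> \<open>Evaluation at \<open>x0\<close>, stripped of its action on the earlier functions
    and divided by the residual \<open>h\<close>: it kills \<open>g j\<close> for
    \<open>j < n\<close> and takes the value 1 on \<open>g n\<close>. Below, \<open>v2\<close> uses
    it to make the old functionals vanish on \<open>g n\<close>.\<close>
  define u where "u x = ((if x = x0 then 1 else 0) - (\<Sum>i<n. g i x0 * v' i x)) / h" for x
  have S': "finite S'" "S' \<subseteq> X" "S \<subseteq> S'" "x0 \<in> S'" using S x0 by (auto simp: S'_def)
  have v'_sum: "(\<Sum>x\<in>S'. v' i x * g j x) = (\<Sum>x\<in>S. v i x * g j x)" for i j
    using S' by (intro sum.mono_neutral_cong_right) (auto simp: v'_def)
  have delta: "(\<Sum>x\<in>S'. (if x = x0 then 1 else 0) * g j x) = g j x0" for j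
    using S' by (simp add: if_distrib[of "\<lambda>t. t * _"] cong: if_cong)
  have u_sum: "(\<Sum>x\<in>S'. u x * g j x) = (g j x0 - (\<Sum>i<n. g i x0 * (\<Sum>x\<in>S. v i x * g j x))) / h" for j
  proof -
    have "(\<Sum>x\<in>S'. u x * g j x) = ((\<Sum>x\<in>S'. (if x = x0 then 1 else 0) * g j x)
        - (\<Sum>x\<in>S'. \<Sum>i<n. g i x0 * v' i x * g j x)) / h"
      by (simp add: u_def sum_divide_distrib[symmetric] sum_subtractf left_diff_distrib sum_distrib_right)
    also have "(\<Sum>x\<in>S'. \<Sum>i<n. g i x0 * v' i x * g j x) = (\<Sum>i<n. g i x0 * (\<Sum>x\<in>S'. v' i x * g j x))"
      by (subst sum.swap) (simp add: sum_distrib_left mult.assoc)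
    finally show ?thesis by (simp only: v'_sum delta)
  qed
  have u1: "(\<Sum>x\<in>S'. u x * g n x) = 1"
    using h0 by (simp add: u_sum h_def b_def mult.commute)
  have u0: "(\<Sum>x\<in>S'. u x * g j x) = 0" if "j < n" for j
    using that by (simp add: u_sum v if_distrib cong: if_cong)
  define v2 where "v2 i x = (if i = n then u x else v' i x - b i * u x)" for i x
  have "(\<Sum>x\<in>S'. v2 i x * g j x) = (if i = j then 1 else 0)" if "i < Suc n" "j < Suc n" for i j
  proof (cases "i = n")
    case True
    then show ?thesis using that u1 u0 by (auto simp: v2_def less_Suc_eq)
  next
    case False
    then have "(\<Sum>x\<in>S'. v2 i x * g j x) = (\<Sum>x\<in>S. v i x * g j x) - b i * (\<Sum>x\<in>S'. u x * g j x)"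
      by (simp add: v2_def left_diff_distrib sum_subtractf v'_sum sum_distrib_left mult.assoc)
    then show ?thesis using that u1 u0 v False by (auto simp: b_def less_Suc_eq)
  qed
  then show ?case using S' by blast
qed

text \<open>Row rank equals column rank. If \<open>A c = 0\<close> with \<open>c k0\<close> nonzero,
  take a nonzero \<open>d\<close> orthogonal to all columns except \<open>k0\<close>; in the pairing
  of \<open>d\<close> with \<open>A c\<close> only column \<open>k0\<close> survives, so
  \<open>d\<close> is orthogonal to that column too and lies in the left kernel.\<close>

lemma trivial_kernel_transpose:
  fixes A :: "nat \<Rightarrow> nat \<Rightarrow> real"
  assumes left: "\<And>c. \<forall>k<n. (\<Sum>i<n. c i * A i k) = 0 \<Longrightarrow> \<forall>i<n. c i = 0"
    and c: "\<forall>i<n. (\<Sum>k<n. A i k * c k) = 0"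
  shows "\<forall>k<n. c k = 0"
proof (rule ccontr)
  assume "\<not> ?thesis"
  then obtain k0 where k0: "k0 < n" "c k0 \<noteq> 0" by blast
  have "card ({..<n} - {k0}) < card {..<n}" using k0 by (auto intro!: psubset_card_mono)
  then obtain d where d: "\<exists>i<n. d i \<noteq> 0" "\<forall>k\<in>{..<n} - {k0}. (\<Sum>i<n. A i k * d i) = 0"
    using homogeneous_system_nontrivial[of "{..<n} - {k0}" "{..<n}" "\<lambda>k i. A i k"]
    by auto
  have "(\<Sum>k<n. (\<Sum>i<n. A i k * d i) * c k) = (\<Sum>i<n. d i * (\<Sum>k<n. A i k * c k))"
    unfolding sum_distrib_left sum_distrib_right
    by (subst sum.swap) (simp add: ac_simps)
  also have "\<dots> = 0" using c by simp
  also have "(\<Sum>k<n. (\<Sum>i<n. A i k * d i) * c k) = (\<Sum>i<n. A i k0 * d i) * c k0"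
    using d(2) k0(1) by (subst sum.remove[of _ k0]) auto
  finally have "(\<Sum>i<n. A i k0 * d i) = 0" using k0 by simp
  with d(2) have "\<forall>k<n. (\<Sum>i<n. d i * A i k) = 0" by (auto simp: mult.commute)
  from left[OF this] d(1) show False by auto
qed

section \<open>Irreducible chains\<close>

lemma stoch_matrix_mpow:
  assumes "stoch_matrix J Q"
  shows "stoch_matrix J (mpow J Q n)"
proof (induction n)
  case 0
  then show ?case by (auto simp: stoch_matrix_def)
next
  case (Suc n)
  have "(\<Sum>k<J. \<Sum>l<J. mpow J Q n i l * Q l k) = 1" if "i < J" for i
    using assms Suc that
    by (subst sum.swap) (auto simp: stoch_matrix_def sum_distrib_left[symmetric])
  then show ?case using assms Suc by (auto simp: stoch_matrix_def intro!: sum_nonneg)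
qed

lemma invariant_mpow:
  assumes "\<forall>k<J. (\<Sum>i<J. c i * Q i k) = c k" "k < J"
  shows "(\<Sum>i<J. c i * mpow J Q n i k) = c k"
  using assms(2)
proof (induction n arbitrary: k)
  case 0
  then show ?case by (simp add: if_distrib cong: if_cong)
next
  case (Suc n)
  have "(\<Sum>i<J. c i * mpow J Q (Suc n) i k) = (\<Sum>l<J. (\<Sum>i<J. c i * mpow J Q n i l) * Q l k)"
    by (simp add: sum_distrib_left sum_distrib_right mult.assoc) (rule sum.swap)
  also have "\<dots> = c k" using Suc assms(1) by simp
  finally show ?case .
qed

text \<open>By irreducibility some power of \<open>Q\<close> moves mass from \<open>i\<close> to
  \<open>k\<close>, and invariance under that power bounds \<open>c k\<close> below by the mass
  moved.\<close>

lemma invariant_nonneg_pos: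
  assumes "stoch_matrix J Q" "irreducible_chain J Q"
    and inv: "\<forall>k<J. (\<Sum>i<J. c i * Q i k) = c k" and nonneg: "\<forall>i<J. c i \<ge> 0"
    and i: "i < J" "c i \<noteq> 0" and k: "k < J"
  shows "c k > (0::real)"
proof -
  obtain n where n: "mpow J Q n i k > 0"
    using assms(2) i k by (auto simp: irreducible_chain_def)
  have Qn: "\<forall>l<J. mpow J Q n l k \<ge> 0"
    using stoch_matrix_mpow[OF assms(1), of n] k by (auto simp: stoch_matrix_def)
  have "0 < c i * mpow J Q n i k" using n i nonneg by (simp add: order_less_le)
  also have "\<dots> \<le> (\<Sum>l<J. c l * mpow J Q n l k)"
    using i Qn nonneg by (intro member_le_sum) auto
  also have "\<dots> = c k" using invariant_mpow[OF inv k] .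
  finally show ?thesis .
qed

lemma invariant_dist_pos:
  assumes "stoch_matrix J Q" "irreducible_chain J Q" "invariant_dist J Q p" "k < J"
  shows "p k > 0"
proof -
  have p: "\<forall>i<J. p i \<ge> 0" "(\<Sum>i<J. p i) = 1" and inv: "\<forall>k<J. (\<Sum>i<J. p i * Q i k) = p k"
    using assms(3) by (auto simp: invariant_dist_def prob_vec_def)
  then obtain i where "i < J" "p i \<noteq> 0"
    by (metis lessThan_iff sum.neutral zero_neq_one)
  then show ?thesis using invariant_nonneg_pos[OF assms(1,2) inv p(1)] assms(4) by blast
qed

text \<open>Uniqueness of the invariant vector. Subtracting the largest multiple of \<open>p\<close>
  that keeps \<open>c\<close> nonnegative creates a zero coordinate, so the remainder is zero by the
  positivity of nonzero invariant vectors; hence \<open>c\<close> is a multiple of \<open>p\<close>,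
  and the zero sum makes the multiple 0.\<close>

lemma invariant_sum_zero:
  assumes "stoch_matrix J Q" "irreducible_chain J Q" "invariant_dist J Q p"
    and inv: "\<forall>k<J. (\<Sum>i<J. c i * Q i k) = c k" and zero: "(\<Sum>i<J. c i) = 0"
  shows "\<forall>i<J. c i = (0::real)"
proof (cases "J = 0")
  case False
  have pinv: "\<forall>k<J. (\<Sum>i<J. p i * Q i k) = p k" and p1: "(\<Sum>i<J. p i) = 1"
    using assms(3) by (auto simp: invariant_dist_def prob_vec_def)
  have pos: "p i > 0" if "i < J" for i using invariant_dist_pos[OF assms(1-3) that] .
  obtain m where m: "m < J" "\<And>i. i < J \<Longrightarrow> c m / p m \<le> c i / p i"
  proof -
    have "Min ((\<lambda>i. c i / p i) ` {..<J}) \<in> (\<lambda>i. c i / p i) ` {..<J}"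
      using False by (intro Min_in) auto
    then obtain m where "m < J" "Min ((\<lambda>i. c i / p i) ` {..<J}) = c m / p m" by auto
    moreover have "Min ((\<lambda>i. c i / p i) ` {..<J}) \<le> c i / p i" if "i < J" for i
      using that by (intro Min_le) auto
    ultimately show ?thesis using that by metis
  qed
  define t where "t = c m / p m"
  define d where "d i = c i - t * p i" for i
  have "\<forall>i<J. d i \<ge> 0" using m(2) pos by (auto simp: d_def t_def pos_le_divide_eq)
  moreover have "d m = 0" using pos[OF m(1)] by (simp add: d_def t_def)
  moreover have "\<forall>k<J. (\<Sum>i<J. d i * Q i k) = d k"
    using inv pinv by (simp add: d_def left_diff_distrib sum_subtractf mult.assoc sum_distrib_left[symmetric])
  ultimately have d0: "d i = 0" if "i < J" for i
    using invariant_nonneg_pos[OF assms(1,2), of d i m] that m(1) by fastforce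
  have "0 = (\<Sum>i<J. d i + t * p i)" using zero by (simp add: d_def)
  also have "\<dots> = t" using d0 p1 by (simp add: sum.distrib sum_distrib_left[symmetric])
  finally show ?thesis using d0 by (simp add: d_def)
qed simp

text \<open>\<open>Z\<close> is the Kemeny--Snell fundamental matrix, the inverse of \<open>I - Q + 1p\<close>. It bounds the
  summed correlations of the chain without any appeal to aperiodicity.\<close>

lemma fundamental_matrix:
  assumes "stoch_matrix J Q" "irreducible_chain J Q" "invariant_dist J Q p"
  shows "\<exists>Z. \<forall>i<J. \<forall>k<J. Z i k - (\<Sum>l<J. Q i l * Z l k) = (if i = k then 1 else 0) - p k"
proof -
  have Q1: "(\<Sum>k<J. Q i k) = 1" if "i < J" for i using assms(1) that by (simp add: stoch_matrix_def)
  have pinv: "\<And>k. k < J \<Longrightarrow> (\<Sum>i<J. p i * Q i k) = p k" and p1: "(\<Sum>i<J. p i) = 1"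
    using assms(3) by (auto simp: invariant_dist_def prob_vec_def)
  define M where "M i k = (if i = k then 1 else 0) - Q i k + p k" for i k :: nat
  have cM: "(\<Sum>i<J. c i * M i k) = c k - (\<Sum>i<J. c i * Q i k) + (\<Sum>i<J. c i) * p k" if "k < J" for c k
  proof -
    have "(\<Sum>i<J. c i * M i k) = (\<Sum>i<J. (if i = k then c k else 0) - c i * Q i k + c i * p k)"
      by (intro sum.cong) (auto simp: M_def algebra_simps)
    then show ?thesis using that by (simp add: sum.distrib sum_subtractf sum_distrib_right)
  qed
  \<comment> \<open>Trivial left kernel of \<open>M = I - Q + 1p\<close>: adding up the columns
    gives total mass 0, after which the equation says that \<open>c\<close> is invariant.\<close>
  have "\<forall>i<J. c i = 0" if c: "\<forall>k\<in>{..<J}. (\<Sum>i<J. c i * M i k) = 0" for c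
  proof -
    have "0 = (\<Sum>k<J. c k - (\<Sum>i<J. c i * Q i k) + (\<Sum>i<J. c i) * p k)"
      using c cM by simp
    also have "\<dots> = (\<Sum>k<J. c k) - (\<Sum>i<J. c i * (\<Sum>k<J. Q i k)) + (\<Sum>i<J. c i) * (\<Sum>k<J. p k)"
      unfolding sum.distrib sum_subtractf sum_distrib_left
      by (subst (2) sum.swap) simp
    also have "\<dots> = (\<Sum>i<J. c i)" using Q1 p1 by simp
    finally have c0: "(\<Sum>i<J. c i) = 0" by simp
    then have "\<forall>k<J. (\<Sum>i<J. c i * Q i k) = c k" using c cM by simp
    from invariant_sum_zero[OF assms this c0] show ?thesis .
  qed
  \<comment> \<open>Functionals dual to the rows of \<open>M\<close> are the columns of a right
    inverse \<open>Z\<close>.\<close>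
  from dual_functionals[of "{..<J}" M J, OF this] obtain S v where S: "finite S" "S \<subseteq> {..<J}"
    and v: "\<forall>i<J. \<forall>j<J. (\<Sum>x\<in>S. v i x * M j x) = (if i = j then 1 else 0)" by blast
  define Z where "Z k i = (if k \<in> S then v i k else 0)" for k i
  have MZ: "(\<Sum>k<J. M j k * Z k i) = (if i = j then 1 else 0)" if "i < J" "j < J" for i j
  proof -
    have "(\<Sum>k<J. M j k * Z k i) = (\<Sum>x\<in>S. v i x * M j x)"
      using S by (intro sum.mono_neutral_cong_right) (auto simp: Z_def)
    then show ?thesis using v that by simp
  qed
  have MZ': "(\<Sum>k<J. M j k * Z k i) = Z j i - (\<Sum>l<J. Q j l * Z l i) + (\<Sum>l<J. p l * Z l i)"
    if "j < J" for i j
  proof -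
    have "(\<Sum>k<J. M j k * Z k i) = (\<Sum>k<J. (if j = k then Z j i else 0) - Q j k * Z k i + p k * Z k i)"
      by (intro sum.cong) (auto simp: M_def algebra_simps)
    then show ?thesis using that by (simp add: sum.distrib sum_subtractf)
  qed
  \<comment> \<open>Since \<open>p M = p\<close>, also \<open>p Z = p M Z = p\<close>. This turns
    \<open>M Z = I\<close> into the stated equation \<open>Z - Q Z = I - 1p\<close>.\<close>
  have pZ: "(\<Sum>l<J. p l * Z l i) = p i" if "i < J" for i
  proof -
    have "p i = (\<Sum>j<J. p j * (\<Sum>k<J. M j k * Z k i))"
      using that by (simp add: MZ if_distrib cong: if_cong)
    also have "\<dots> = (\<Sum>k<J. (\<Sum>j<J. p j * M j k) * Z k i)"
      by (simp add: sum_distrib_left sum_distrib_right mult.assoc) (rule sum.swap)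
    also have "\<dots> = (\<Sum>l<J. p l * Z l i)" using cM[of _ p] pinv p1 by simp
    finally show ?thesis ..
  qed
  show ?thesis
  proof (intro exI[of _ Z] allI impI)
    fix i k assume "i < J" "k < J"
    then show "Z i k - (\<Sum>l<J. Q i l * Z l k) = (if i = k then 1 else 0) - p k"
      using MZ[of k i] MZ'[of i k] pZ[of k] by auto
  qed
qed

text \<open>Multiplying the equation for \<open>Z\<close> by the \<open>r\<close>-th power of
  \<open>Q\<close> makes the sum telescope to \<open>Z\<close> minus the \<open>n\<close>-th power
  times \<open>Z\<close>. Rows of a power are probability vectors, so each of the two terms is
  bounded by \<open>B\<close>, whatever \<open>n\<close> is.\<close>

lemma sum_mpow_bounded:
  assumes "stoch_matrix J Q" "irreducible_chain J Q" "invariant_dist J Q p"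
  obtains B where "B \<ge> 0" "\<And>n i k. i < J \<Longrightarrow> k < J \<Longrightarrow> \<bar>\<Sum>r<n. (mpow J Q r i k - p k)\<bar> \<le> B"
proof -
  obtain Z where Z: "\<And>i k. i < J \<Longrightarrow> k < J \<Longrightarrow>
    Z i k - (\<Sum>l<J. Q i l * Z l k) = (if i = k then 1 else 0) - p k"
    using fundamental_matrix[OF assms] by blast
  define B where "B = (\<Sum>i<J. \<Sum>k<J. \<bar>Z i k\<bar>)"
  have ZB: "\<bar>Z i k\<bar> \<le> B" if "i < J" "k < J" for i k
  proof -
    have "\<bar>Z i k\<bar> \<le> (\<Sum>k<J. \<bar>Z i k\<bar>)" using that by (intro member_le_sum) auto
    also have "\<dots> \<le> B" unfolding B_def using that
      by (intro member_le_sum[of i "{..<J}" "\<lambda>i. \<Sum>k<J. \<bar>Z i k\<bar>"]) (auto intro: sum_nonneg)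
    finally show ?thesis .
  qed
  have Qn: "mpow J Q n i k \<ge> 0" "(\<Sum>k<J. mpow J Q n i k) = 1" if "i < J" "k < J" for n i k
    using stoch_matrix_mpow[OF assms(1), of n] that by (auto simp: stoch_matrix_def)
  have tele: "(\<Sum>r<n. (mpow J Q r i k - p k)) = Z i k - (\<Sum>l<J. mpow J Q n i l * Z l k)"
    if "i < J" "k < J" for n i k
  proof (induction n)
    case 0
    then show ?case using that by (simp add: if_distrib[of "\<lambda>t. t * _"] cong: if_cong)
  next
    case (Suc n)
    have "(\<Sum>l<J. mpow J Q (Suc n) i l * Z l k) = (\<Sum>m<J. mpow J Q n i m * (\<Sum>l<J. Q m l * Z l k))"
      by (simp add: sum_distrib_left sum_distrib_right mult.assoc) (rule sum.swap)
    also have "\<dots> = (\<Sum>m<J. mpow J Q n i m * (Z m k - (if m = k then 1 else 0) + p k))"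
      using Z that by (intro sum.cong refl) (auto simp: algebra_simps)
    also have "\<dots> = (\<Sum>m<J. mpow J Q n i m * Z m k - (if m = k then mpow J Q n i k else 0)
        + mpow J Q n i m * p k)"
      by (intro sum.cong) (auto simp: algebra_simps)
    also have "\<dots> = (\<Sum>m<J. mpow J Q n i m * Z m k) - mpow J Q n i k + p k"
      using that Qn(2)[OF that, of n] by (simp add: sum.distrib sum_subtractf sum_distrib_right[symmetric])
    finally show ?case using Suc by simp
  qed
  have "\<bar>\<Sum>r<n. (mpow J Q r i k - p k)\<bar> \<le> B + B" if "i < J" "k < J" for n i k
  proof -
    have "\<bar>\<Sum>l<J. mpow J Q n i l * Z l k\<bar> \<le> (\<Sum>l<J. mpow J Q n i l * B)"
      using that Qn ZB by (intro order_trans[OF sum_abs] sum_mono) (auto simp: abs_mult intro!: mult_left_mono)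
    also have "\<dots> = B" using Qn(2)[OF that, of n] by (simp add: sum_distrib_right[symmetric])
    finally show ?thesis unfolding tele[OF that] using ZB[OF that] by linarith
  qed
  moreover have "B + B \<ge> 0" by (auto simp: B_def intro!: add_nonneg_nonneg sum_nonneg)
  ultimately show ?thesis using that by blast
qed

section \<open>Stability of the spectral inversion\<close>

text \<open>With emission values for \<open>a\<close>, \<open>b\<close>, \<open>c\<close> this is
  the joint law of three consecutive observations of the stationary chain; \<open>b = 1\<close>
  integrates out the middle one.\<close>

definition trilinear :: "nat \<Rightarrow> (nat \<Rightarrow> nat \<Rightarrow> real) \<Rightarrow> (nat \<Rightarrow> real)
    \<Rightarrow> (nat \<Rightarrow> real) \<Rightarrow> (nat \<Rightarrow> real) \<Rightarrow> (nat \<Rightarrow> real) \<Rightarrow> real" where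
  "trilinear J Q p a b c = (\<Sum>i<J. p i * a i * (\<Sum>j<J. Q i j * b j * (\<Sum>k<J. Q j k * c k)))"

text \<open>Conditioning on the middle state: past and future separate, and \<open>b\<close> enters
  as a diagonal matrix between them.\<close>

lemma trilinear_alt:
  "trilinear J Q p a b c = (\<Sum>j<J. (\<Sum>i<J. p i * Q i j * a i) * b j * (\<Sum>k<J. Q j k * c k))"
proof -
  define g where "g j = (\<Sum>k<J. Q j k * c k)" for j
  have "(\<Sum>i<J. p i * a i * (\<Sum>j<J. Q i j * b j * g j)) = (\<Sum>j<J. (\<Sum>i<J. p i * Q i j * a i) * b j * g j)"
    unfolding sum_distrib_left sum_distrib_right by (subst sum.swap) (simp add: ac_simps)
  then show ?thesis by (simp add: trilinear_def g_def)
qed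

lemma trilinear_contract:
  assumes "finite S" "finite S'"
  shows "(\<Sum>x\<in>S. \<Sum>z\<in>S'. u x * v z * trilinear J Q p (\<lambda>i. f i x) b (\<lambda>k. f k z))
    = (\<Sum>j<J. (\<Sum>x\<in>S. u x * (\<Sum>i<J. p i * Q i j * f i x)) * (\<Sum>z\<in>S'. v z * (\<Sum>k<J. Q j k * f k z)) * b j)"
proof -
  have "(\<Sum>x\<in>S. \<Sum>z\<in>S'. u x * v z * trilinear J Q p (\<lambda>i. f i x) b (\<lambda>k. f k z))
    = (\<Sum>x\<in>S. \<Sum>z\<in>S'. \<Sum>j<J. (u x * (\<Sum>i<J. p i * Q i j * f i x)) * (v z * (\<Sum>k<J. Q j k * f k z)) * b j)"
  proof (intro sum.cong refl)
    fix x z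
    define F where "F j = (\<Sum>i<J. p i * Q i j * f i x)" for j
    define G where "G j = (\<Sum>k<J. Q j k * f k z)" for j
    have "u x * v z * (\<Sum>j<J. F j * b j * G j) = (\<Sum>j<J. (u x * F j) * (v z * G j) * b j)"
      by (simp add: sum_distrib_left ac_simps)
    then show "u x * v z * trilinear J Q p (\<lambda>i. f i x) b (\<lambda>k. f k z) =
      (\<Sum>j<J. (u x * (\<Sum>i<J. p i * Q i j * f i x)) * (v z * (\<Sum>k<J. Q j k * f k z)) * b j)"
      by (simp only: trilinear_alt F_def G_def)
  qed
  also have "\<dots> = (\<Sum>x\<in>S. \<Sum>j<J. \<Sum>z\<in>S'. (u x * (\<Sum>i<J. p i * Q i j * f i x)) * (v z * (\<Sum>k<J. Q j k * f k z)) * b j)"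
    by (intro sum.cong refl sum.swap)
  also have "\<dots> = (\<Sum>j<J. \<Sum>x\<in>S. \<Sum>z\<in>S'. (u x * (\<Sum>i<J. p i * Q i j * f i x)) * (v z * (\<Sum>k<J. Q j k * f k z)) * b j)"
    by (rule sum.swap)
  also have "\<dots> = (\<Sum>j<J. (\<Sum>x\<in>S. u x * (\<Sum>i<J. p i * Q i j * f i x)) * (\<Sum>z\<in>S'. v z * (\<Sum>k<J. Q j k * f k z)) * b j)"
  proof (intro sum.cong refl)
    fix j
    have "(\<Sum>x\<in>S. \<Sum>z\<in>S'. g x * h z * d) = sum g S * sum h S' * d" for g h :: "_ \<Rightarrow> real" and d
      by (simp only: sum_product) (simp only: sum_distrib_right)
    then show "(\<Sum>x\<in>S. \<Sum>z\<in>S'. (u x * (\<Sum>i<J. p i * Q i j * f i x)) * (v z * (\<Sum>k<J. Q j k * f k z)) * b j)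
      = (\<Sum>x\<in>S. u x * (\<Sum>i<J. p i * Q i j * f i x)) * (\<Sum>z\<in>S'. v z * (\<Sum>k<J. Q j k * f k z)) * b j" .
  qed
  finally show ?thesis .
qed

text \<open>A vector \<open>w\<close> with \<open>V\<^sup>T w\<close> supported on coordinate \<open>j\<close> satisfies
  \<open>T(y) w = f'\<^sub>j(y) T(1) w\<close> for \<open>T(b) = U diag(b) V\<^sup>T\<close>; comparing the
  largest coordinate of \<open>w\<close> shows that \<open>f'\<^sub>j\<close> is close to a diagonal entry.\<close>

lemma approximate_joint_diagonalization:
  fixes U V f f' :: "nat \<Rightarrow> _ \<Rightarrow> real"
  assumes Tf: "\<And>y i k. i < J \<Longrightarrow> k < J \<Longrightarrow>
      \<bar>(\<Sum>j<J. U i j * V k j * f' j y) - (if i = k then f i y else 0)\<bar> \<le> e"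
    and T1: "\<And>i k. i < J \<Longrightarrow> k < J \<Longrightarrow> \<bar>(\<Sum>j<J. U i j * V k j) - (if i = k then 1 else 0)\<bar> \<le> e"
    and f': "\<And>y. \<bar>f' j y\<bar> \<le> 1" and j: "j < J"
  shows "\<exists>i<J. \<forall>y. \<bar>f' j y - f i y\<bar> \<le> 2 * real J * e"
proof -
  \<comment> \<open>Only \<open>J - 1\<close> equations are imposed on the \<open>J\<close>
    coordinates of \<open>w\<close>, which leaves a nonzero solution.\<close>
  have "card ({..<J} - {j}) < card {..<J}" using j by (auto intro!: psubset_card_mono)
  then obtain w where w: "\<exists>k<J. w k \<noteq> 0" "\<forall>l\<in>{..<J} - {j}. (\<Sum>k<J. V k l * w k) = 0"
    using homogeneous_system_nontrivial[of "{..<J} - {j}" "{..<J}" "\<lambda>l k. V k l"] by auto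
  define s where "s = (\<Sum>k<J. V k j * w k)"
  have Tw: "(\<Sum>k<J. (\<Sum>l<J. U i l * V k l * b l) * w k) = U i j * s * b j" for i and b :: "nat \<Rightarrow> real"
  proof -
    have "(\<Sum>k<J. (\<Sum>l<J. U i l * V k l * b l) * w k) = (\<Sum>l<J. U i l * b l * (\<Sum>k<J. V k l * w k))"
      by (simp add: sum_distrib_left sum_distrib_right ac_simps) (rule sum.swap)
    also have "\<dots> = (\<Sum>l<J. if l = j then U i j * b j * s else 0)"
      using w(2) by (intro sum.cong) (auto simp: s_def)
    finally show ?thesis using j by simp
  qed
  have "Max ((\<lambda>i. \<bar>w i\<bar>) ` {..<J}) \<in> (\<lambda>i. \<bar>w i\<bar>) ` {..<J}" using j by (intro Max_in) auto
  then obtain i where i: "i < J" "Max ((\<lambda>i. \<bar>w i\<bar>) ` {..<J}) = \<bar>w i\<bar>" by auto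
  have max: "\<bar>w k\<bar> \<le> \<bar>w i\<bar>" if "k < J" for k
    using that unfolding i(2)[symmetric] by (intro Max_ge) auto
  have wi: "\<bar>w i\<bar> > 0" using w(1) max by fastforce
  \<comment> \<open>Row \<open>i\<close> of a matrix within \<open>e\<close> of a diagonal one,
    applied to \<open>w\<close>. As \<open>i\<close> maximises the modulus of \<open>w\<close>, all
    errors are relative to \<open>\<bar>w i\<bar>\<close>, which is finally divided out.\<close>
  have close: "\<bar>(\<Sum>k<J. T k * w k) - d * w i\<bar> \<le> real J * (e * \<bar>w i\<bar>)"
    if T: "\<And>k. k < J \<Longrightarrow> \<bar>T k - (if i = k then d else 0)\<bar> \<le> e" for T d
  proof -
    have "(\<Sum>k<J. T k * w k) - d * w i = (\<Sum>k<J. T k * w k - (if i = k then d * w i else 0))"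
      using i by (simp add: sum_subtractf)
    also have "\<bar>\<dots>\<bar> \<le> (\<Sum>k<J. \<bar>T k * w k - (if i = k then d * w i else 0)\<bar>)" by (rule sum_abs)
    also have "\<dots> \<le> (\<Sum>k<J. e * \<bar>w i\<bar>)"
    proof (rule sum_mono)
      fix k assume k: "k \<in> {..<J}"
      have "\<bar>T k * w k - (if i = k then d * w i else 0)\<bar> = \<bar>T k - (if i = k then d else 0)\<bar> * \<bar>w k\<bar>"
        by (auto simp: abs_mult[symmetric] algebra_simps)
      also have "\<dots> \<le> e * \<bar>w i\<bar>" using T[of k] max[of k] k by (intro mult_mono) auto
      finally show "\<bar>T k * w k - (if i = k then d * w i else 0)\<bar> \<le> e * \<bar>w i\<bar>" .
    qed
    finally show ?thesis by simp
  qed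
  have "\<bar>f' j y - f i y\<bar> \<le> 2 * real J * e" for y
  proof -
    have 1: "\<bar>U i j * s * f' j y - f i y * w i\<bar> \<le> real J * (e * \<bar>w i\<bar>)"
      using close[OF Tf[of i _ y]] i(1) Tw[of i "\<lambda>l. f' l y"] by simp
    have "\<bar>U i j * s - w i\<bar> \<le> real J * (e * \<bar>w i\<bar>)"
      using close[OF T1[of i]] i(1) Tw[of i "\<lambda>l. 1"] by simp
    \<comment> \<open>Scaling by \<open>f' j y\<close> makes both estimates speak about the same
      quantity \<open>U i j * s * f' j y\<close>, which is then eliminated.\<close>
    then have "\<bar>f' j y\<bar> * \<bar>U i j * s - w i\<bar> \<le> 1 * (real J * (e * \<bar>w i\<bar>))"
      using f' by (intro mult_mono) auto
    then have 2: "\<bar>f' j y * (U i j * s) - f' j y * w i\<bar> \<le> real J * (e * \<bar>w i\<bar>)"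
      by (simp add: abs_mult[symmetric] algebra_simps)
    have "\<bar>f' j y - f i y\<bar> * \<bar>w i\<bar> = \<bar>f' j y * w i - f i y * w i\<bar>"
      by (simp add: abs_mult[symmetric] algebra_simps)
    also have "\<dots> \<le> (2 * real J * e) * \<bar>w i\<bar>"
      using 1 2 by (simp add: algebra_simps abs_le_iff)
    finally show ?thesis using wi by simp
  qed
  then show ?thesis using i by blast
qed

lemma emission_pmfs_bounds:
  assumes "emission_pmfs J f" "j < J"
  shows "0 \<le> f j x" "f j x \<le> 1"
proof -
  have f: "\<And>x. f j x \<ge> 0" "(f j has_sum 1) UNIV" using assms by (auto simp: emission_pmfs_def)
  then show "0 \<le> f j x" by blast
  have "(f j has_sum f j x) {x}" using has_sum_finite[of "{x}" "f j"] by simp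
  then show "f j x \<le> 1" using f has_sum_mono2[of "f j" "{x}" "f j x" UNIV 1] by auto
qed

text \<open>The constants depend on the true parameter alone, through the l1 norms of its dual
  functionals; the nearby parameter ranges over all admissible ones.\<close>

lemma inverse_stability:
  assumes "A2' J Q p" "A3 J f"
  shows "\<exists>C e0. C > 0 \<and> e0 > 0 \<and> (\<forall>Q' p' f' r. A2' J Q' p' \<longrightarrow> A3 J f' \<longrightarrow> r \<le> e0 \<longrightarrow>
    (\<forall>x y z. \<bar>trilinear J Q' p' (\<lambda>i. f' i x) (\<lambda>i. f' i y) (\<lambda>i. f' i z)
       - trilinear J Q p (\<lambda>i. f i x) (\<lambda>i. f i y) (\<lambda>i. f i z)\<bar> \<le> r) \<longrightarrow>
    (\<forall>x z. \<bar>trilinear J Q' p' (\<lambda>i. f' i x) (\<lambda>i. 1) (\<lambda>i. f' i z)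
       - trilinear J Q p (\<lambda>i. f i x) (\<lambda>i. 1) (\<lambda>i. f i z)\<bar> \<le> r) \<longrightarrow>
    (\<exists>\<tau>. bij_betw \<tau> {..<J} {..<J} \<and> (\<forall>j<J. \<forall>y. \<bar>f' j y - f (\<tau> j) y\<bar> \<le> C * r)))"
proof -
  have Q: "stoch_matrix J Q" "irreducible_chain J Q" "invariant_dist J Q p" and
    rank: "\<And>c. \<forall>k<J. (\<Sum>i<J. c i * Q i k) = 0 \<Longrightarrow> \<forall>i<J. c i = 0"
    using assms(1) by (auto simp: A2'_def full_rank_def)
  have f: "\<And>c. \<forall>x\<in>UNIV. (\<Sum>j<J. c j * f j x) = 0 \<Longrightarrow> \<forall>j<J. c j = 0"
    using assms(2) by (auto simp: A3_def lin_indep_fun_def)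
  have ppos: "p k > 0" if "k < J" for k using invariant_dist_pos[OF Q that] .
  define F where "F j x = (\<Sum>i<J. p i * Q i j * f i x)" for j x
  define G where "G j x = (\<Sum>k<J. Q j k * f k x)" for j x
  \<comment> \<open>\<open>G\<close> is \<open>Q\<close> applied to \<open>f\<close>, so
    independence follows from that of \<open>f\<close> and the trivial left kernel of
    \<open>Q\<close>.\<close>
  have Gind: "\<forall>j<J. c j = 0" if "\<forall>x\<in>UNIV. (\<Sum>j<J. c j * G j x) = 0" for c
  proof -
    have "(\<Sum>j<J. c j * G j x) = (\<Sum>k<J. (\<Sum>j<J. c j * Q j k) * f k x)" for x
      by (simp add: G_def sum_distrib_left sum_distrib_right mult.assoc) (rule sum.swap)
    then have "\<forall>x\<in>UNIV. (\<Sum>k<J. (\<Sum>j<J. c j * Q j k) * f k x) = 0" using that by simp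
    from rank[OF f[OF this]] show ?thesis .
  qed
  \<comment> \<open>\<open>F\<close> is the transpose of \<open>diag(p) Q\<close> applied to
    \<open>f\<close>: positivity of \<open>p\<close> removes the diagonal factor, and the trivial
    right kernel of \<open>Q\<close> does the rest.\<close>
  have Find: "\<forall>j<J. c j = 0" if "\<forall>x\<in>UNIV. (\<Sum>j<J. c j * F j x) = 0" for c
  proof -
    have "(\<Sum>j<J. c j * F j x) = (\<Sum>i<J. (p i * (\<Sum>j<J. Q i j * c j)) * f i x)" for x
      by (simp add: F_def sum_distrib_left sum_distrib_right ac_simps) (rule sum.swap)
    then have "\<forall>x\<in>UNIV. (\<Sum>i<J. (p i * (\<Sum>j<J. Q i j * c j)) * f i x) = 0" using that by simp
    from f[OF this] have "\<forall>i<J. (\<Sum>j<J. Q i j * c j) = 0" using ppos by fastforce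
    from trivial_kernel_transpose[OF rank this] show ?thesis .
  qed
  obtain Sf v where Sf: "finite Sf" and
    v: "\<And>i j. i < J \<Longrightarrow> j < J \<Longrightarrow> (\<Sum>x\<in>Sf. v i x * f j x) = (if i = j then 1 else 0)"
    using dual_functionals[of UNIV f J, OF f] by auto
  obtain Sa \<alpha> where Sa: "finite Sa" and
    \<alpha>: "\<And>i j. i < J \<Longrightarrow> j < J \<Longrightarrow> (\<Sum>x\<in>Sa. \<alpha> i x * F j x) = (if i = j then 1 else 0)"
    using dual_functionals[of UNIV F J, OF Find] by auto
  obtain Sb \<beta> where Sb: "finite Sb" and
    \<beta>: "\<And>i j. i < J \<Longrightarrow> j < J \<Longrightarrow> (\<Sum>x\<in>Sb. \<beta> i x * G j x) = (if i = j then 1 else 0)"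
    using dual_functionals[of UNIV G J, OF Gind] by auto
  define Ka where "Ka = (\<Sum>i<J. \<Sum>x\<in>Sa. \<bar>\<alpha> i x\<bar>)"
  define Kb where "Kb = (\<Sum>i<J. \<Sum>x\<in>Sb. \<bar>\<beta> i x\<bar>)"
  define L where "L = (\<Sum>i<J. \<Sum>x\<in>Sf. \<bar>v i x\<bar>)"
  have Ka: "(\<Sum>x\<in>Sa. \<bar>\<alpha> i x\<bar>) \<le> Ka" and Kb: "(\<Sum>x\<in>Sb. \<bar>\<beta> i x\<bar>) \<le> Kb"
    and L: "(\<Sum>x\<in>Sf. \<bar>v i x\<bar>) \<le> L" if "i < J" for i
    using that member_le_sum[of i "{..<J}" "\<lambda>i. \<Sum>x\<in>Sa. \<bar>\<alpha> i x\<bar>"]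
      member_le_sum[of i "{..<J}" "\<lambda>i. \<Sum>x\<in>Sb. \<bar>\<beta> i x\<bar>"]
      member_le_sum[of i "{..<J}" "\<lambda>i. \<Sum>x\<in>Sf. \<bar>v i x\<bar>"]
    by (auto simp: Ka_def Kb_def L_def sum_nonneg)
  have nonneg: "Ka \<ge> 0" "Kb \<ge> 0" "L \<ge> 0" by (auto simp: Ka_def Kb_def L_def intro!: sum_nonneg)
  define K where "K = Ka * Kb"
  have K0: "K \<ge> 0" using nonneg by (simp add: K_def)
  \<comment> \<open>\<open>K\<close> bounds both the error amplification of the contraction and the
    products \<open>U i j * V i j\<close>. The summand 1 keeps \<open>C\<close> positive.
    \<open>D * r\<close> will bound a quantity that would be at least 1 if some true density were
    missed; the threshold \<open>1 / (2 * (D + 1))\<close> excludes this.\<close>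
  define C where "C = 2 * real J * K + 1"
  define D where "D = L * K + real J * K * (L * C)"
  have C: "C > 0" using K0 by (simp add: C_def add_nonneg_pos)
  have D: "D \<ge> 0" using K0 nonneg C by (simp add: D_def)
  show ?thesis
  proof (rule exI[of _ C], rule exI[of _ "1 / (2 * (D + 1))"], intro conjI allI impI)
    show "C > 0" by fact
    show "1 / (2 * (D + 1)) > 0" using D by simp
    fix Q' p' f' r
    assume A: "A2' J Q' p'" "A3 J f'" and r: "r \<le> 1 / (2 * (D + 1))"
      and r3: "\<forall>x y z. \<bar>trilinear J Q' p' (\<lambda>i. f' i x) (\<lambda>i. f' i y) (\<lambda>i. f' i z)
       - trilinear J Q p (\<lambda>i. f i x) (\<lambda>i. f i y) (\<lambda>i. f i z)\<bar> \<le> r"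
      and r2: "\<forall>x z. \<bar>trilinear J Q' p' (\<lambda>i. f' i x) (\<lambda>i. 1) (\<lambda>i. f' i z)
       - trilinear J Q p (\<lambda>i. f i x) (\<lambda>i. 1) (\<lambda>i. f i z)\<bar> \<le> r"
    have r0: "r \<ge> 0" using r2 by (meson abs_ge_zero order_trans)
    have Q'0: "Q' i j \<ge> 0" and Q'1: "(\<Sum>k<J. Q' i k) = 1" and p'0: "p' i \<ge> 0" if "i < J" "j < J" for i j
      using A(1) that by (auto simp: A2'_def stoch_matrix_def invariant_dist_def prob_vec_def)
    have p'1: "(\<Sum>i<J. p' i) = 1" using A(1) by (auto simp: A2'_def invariant_dist_def prob_vec_def)
    have f'0: "f' j x \<ge> 0" and f'1: "f' j x \<le> 1" if "j < J" for j x
      using A(2) that emission_pmfs_bounds by (auto simp: A3_def)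
    define U where "U i j = (\<Sum>x\<in>Sa. \<alpha> i x * (\<Sum>l<J. p' l * Q' l j * f' l x))" for i j
    define V where "V k j = (\<Sum>z\<in>Sb. \<beta> k z * (\<Sum>l<J. Q' j l * f' l z))" for k j
    \<comment> \<open>On the true law the dual functionals produce the diagonal matrix exactly, so
      the difference of the two laws contributes at most \<open>r\<close> times the two l1
      norms.\<close>
    have contract: "\<bar>(\<Sum>j<J. U i j * V k j * b' j) - (if i = k then b i else 0)\<bar> \<le> K * r"
      if ik: "i < J" "k < J" and b: "\<forall>x z. \<bar>trilinear J Q' p' (\<lambda>i. f' i x) b' (\<lambda>i. f' i z)
       - trilinear J Q p (\<lambda>i. f i x) b (\<lambda>i. f i z)\<bar> \<le> r" for i k b b'
    proof -
      have "(\<Sum>x\<in>Sa. \<Sum>z\<in>Sb. \<alpha> i x * \<beta> k z * trilinear J Q p (\<lambda>i. f i x) b (\<lambda>i. f i z))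
        = (\<Sum>j<J. (if i = j then 1 else 0) * (if k = j then 1 else 0) * b j)"
        unfolding trilinear_contract[OF Sa Sb] F_def[symmetric] G_def[symmetric]
        using \<alpha> \<beta> ik by (intro sum.cong) auto
      also have "\<dots> = (\<Sum>j<J. if i = j then (if i = k then b i else 0) else 0)" by (intro sum.cong) auto
      also have "\<dots> = (if i = k then b i else 0)" using ik by simp
      finally have 1: "(if i = k then b i else 0)
        = (\<Sum>x\<in>Sa. \<Sum>z\<in>Sb. \<alpha> i x * \<beta> k z * trilinear J Q p (\<lambda>i. f i x) b (\<lambda>i. f i z))" ..
      have 2: "(\<Sum>j<J. U i j * V k j * b' j)
        = (\<Sum>x\<in>Sa. \<Sum>z\<in>Sb. \<alpha> i x * \<beta> k z * trilinear J Q' p' (\<lambda>i. f' i x) b' (\<lambda>i. f' i z))"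
        unfolding trilinear_contract[OF Sa Sb] U_def V_def ..
      have "\<bar>(\<Sum>j<J. U i j * V k j * b' j) - (if i = k then b i else 0)\<bar>
        \<le> (\<Sum>x\<in>Sa. \<Sum>z\<in>Sb. \<bar>\<alpha> i x * \<beta> k z * (trilinear J Q' p' (\<lambda>i. f' i x) b' (\<lambda>i. f' i z)
           - trilinear J Q p (\<lambda>i. f i x) b (\<lambda>i. f i z))\<bar>)"
        unfolding 1 2 sum_subtractf[symmetric] right_diff_distrib[symmetric]
        by (intro order_trans[OF sum_abs] sum_mono) (rule order_refl)
      also have "\<dots> \<le> (\<Sum>x\<in>Sa. \<Sum>z\<in>Sb. \<bar>\<alpha> i x\<bar> * \<bar>\<beta> k z\<bar> * r)"
        unfolding abs_mult using b by (intro sum_mono mult_left_mono) auto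
      also have "\<dots> = (\<Sum>x\<in>Sa. \<bar>\<alpha> i x\<bar>) * (\<Sum>z\<in>Sb. \<bar>\<beta> k z\<bar>) * r"
        by (simp only: sum_product) (simp only: sum_distrib_right)
      also have "\<dots> \<le> K * r" unfolding K_def
        using Ka Kb ik nonneg r0 by (intro mult_right_mono mult_mono) (auto intro: sum_nonneg)
      finally show ?thesis .
    qed
    have Tf: "\<bar>(\<Sum>j<J. U i j * V k j * f' j y) - (if i = k then f i y else 0)\<bar> \<le> K * r"
      if "i < J" "k < J" for i k y
      using r3 by (intro contract[OF that]) auto
    have T1: "\<bar>(\<Sum>j<J. U i j * V k j) - (if i = k then 1 else 0)\<bar> \<le> K * r" if "i < J" "k < J" for i k
      using contract[OF that, of "\<lambda>_. 1" "\<lambda>_. 1"] r2 by simp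
    have "\<exists>i<J. \<forall>y. \<bar>f' j y - f i y\<bar> \<le> 2 * real J * (K * r)" if "j < J" for j
      using that f'0 f'1 by (intro approximate_joint_diagonalization[OF Tf T1]) (auto simp: abs_le_iff
          intro: order_trans[of _ 0])
    moreover have "2 * real J * (K * r) \<le> C * r" using r0 by (simp add: C_def algebra_simps)
    ultimately have "\<forall>j<J. \<exists>i<J. \<forall>y. \<bar>f' j y - f i y\<bar> \<le> C * r" by (meson order_trans)
    then obtain \<tau> where \<tau>: "\<And>j. j < J \<Longrightarrow> \<tau> j < J"
      and close: "\<And>j y. j < J \<Longrightarrow> \<bar>f' j y - f (\<tau> j) y\<bar> \<le> C * r" by metis
    \<comment> \<open>The sums inside \<open>U\<close> and \<open>V\<close> are probabilities under
      the primed parameter (of an observation jointly with the next state, and of an observation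
      given the previous state), hence at most 1 in modulus.\<close>
    have UV: "\<bar>U i j * V i j\<bar> \<le> K" if ij: "i < J" "j < J" for i j
    proof -
      have 1: "\<bar>\<Sum>l<J. p' l * Q' l j * f' l x\<bar> \<le> 1" for x
      proof -
        have "\<bar>\<Sum>l<J. p' l * Q' l j * f' l x\<bar> = (\<Sum>l<J. p' l * Q' l j * f' l x)"
          using ij Q'0 p'0 f'0 by (intro abs_of_nonneg sum_nonneg) auto
        also have "\<dots> \<le> (\<Sum>l<J. p' l * 1 * 1)"
        proof (intro sum_mono mult_mono)
          fix l assume l: "l \<in> {..<J}"
          have "Q' l j \<le> (\<Sum>k<J. Q' l k)" using l ij Q'0 by (intro member_le_sum) auto
          then show "Q' l j \<le> 1" using Q'1 l by auto
        qed (use ij Q'0 p'0 f'0 f'1 in auto)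
        finally show ?thesis using p'1 by simp
      qed
      have 2: "\<bar>\<Sum>l<J. Q' j l * f' l z\<bar> \<le> 1" for z
      proof -
        have "\<bar>\<Sum>l<J. Q' j l * f' l z\<bar> = (\<Sum>l<J. Q' j l * f' l z)"
          using ij Q'0 f'0 by (intro abs_of_nonneg sum_nonneg) auto
        also have "\<dots> \<le> (\<Sum>l<J. Q' j l * 1)"
          using ij Q'0 f'1 by (intro sum_mono mult_left_mono) auto
        finally show ?thesis using Q'1 ij by simp
      qed
      have "\<bar>U i j\<bar> \<le> (\<Sum>x\<in>Sa. \<bar>\<alpha> i x\<bar> * 1)"
        unfolding U_def using 1 by (intro order_trans[OF sum_abs] sum_mono) (simp add: abs_mult mult_left_le)
      then have U: "\<bar>U i j\<bar> \<le> Ka" using Ka[OF ij(1)] by simp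
      have "\<bar>V i j\<bar> \<le> (\<Sum>x\<in>Sb. \<bar>\<beta> i x\<bar> * 1)"
        unfolding V_def using 2 by (intro order_trans[OF sum_abs] sum_mono) (simp add: abs_mult mult_left_le)
      then have V: "\<bar>V i j\<bar> \<le> Kb" using Kb[OF ij(1)] by simp
      show ?thesis unfolding abs_mult K_def using U V nonneg by (intro mult_mono) auto
    qed
    \<comment> \<open>If \<open>i\<close> is missed, every \<open>f' j\<close> is close to a density
      annihilated by the functional \<open>v i\<close>. But \<open>f i\<close>, on which
      \<open>v i\<close> equals 1, is up to \<open>K * r\<close> the combination of the
      \<open>f' j\<close> with bounded coefficients \<open>U i j * V i j\<close>.\<close>
    have surj: "{..<J} \<subseteq> \<tau> ` {..<J}"
    proof
      fix i assume "i \<in> {..<J}"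
      then have i: "i < J" by simp
      show "i \<in> \<tau> ` {..<J}"
      proof (rule ccontr)
        assume no: "i \<notin> \<tau> ` {..<J}"
        have vf: "\<bar>\<Sum>y\<in>Sf. v i y * f' j y\<bar> \<le> L * (C * r)" if j: "j < J" for j
        proof -
          have "(\<Sum>y\<in>Sf. v i y * f (\<tau> j) y) = 0" using v[OF i \<tau>[OF j]] no j by auto
          then have "(\<Sum>y\<in>Sf. v i y * f' j y) = (\<Sum>y\<in>Sf. v i y * (f' j y - f (\<tau> j) y))"
            by (simp add: right_diff_distrib sum_subtractf)
          also have "\<bar>\<dots>\<bar> \<le> (\<Sum>y\<in>Sf. \<bar>v i y\<bar> * (C * r))"
            using close[OF j] by (intro order_trans[OF sum_abs] sum_mono) (simp add: abs_mult mult_left_mono)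
          also have "\<dots> \<le> L * (C * r)" unfolding sum_distrib_right[symmetric]
            using L[OF i] C r0 by (intro mult_right_mono) auto
          finally show ?thesis .
        qed
        have "(\<Sum>y\<in>Sf. v i y * ((\<Sum>j<J. U i j * V i j * f' j y) - f i y))
          = (\<Sum>j<J. U i j * V i j * (\<Sum>y\<in>Sf. v i y * f' j y)) - (\<Sum>y\<in>Sf. v i y * f i y)"
          by (simp add: right_diff_distrib sum_subtractf sum_distrib_left ac_simps) (rule sum.swap)
        also have "(\<Sum>y\<in>Sf. v i y * f i y) = 1" using v i by simp
        finally have eq: "1 = (\<Sum>j<J. U i j * V i j * (\<Sum>y\<in>Sf. v i y * f' j y))
          - (\<Sum>y\<in>Sf. v i y * ((\<Sum>j<J. U i j * V i j * f' j y) - f i y))" by simp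
        have b1: "\<bar>\<Sum>y\<in>Sf. v i y * ((\<Sum>j<J. U i j * V i j * f' j y) - f i y)\<bar> \<le> L * (K * r)"
        proof -
          have "\<bar>\<Sum>y\<in>Sf. v i y * ((\<Sum>j<J. U i j * V i j * f' j y) - f i y)\<bar> \<le> (\<Sum>y\<in>Sf. \<bar>v i y\<bar> * (K * r))"
            using Tf[OF i i] by (intro order_trans[OF sum_abs] sum_mono) (simp add: abs_mult mult_left_mono)
          also have "\<dots> \<le> L * (K * r)" unfolding sum_distrib_right[symmetric]
            using L[OF i] K0 r0 by (intro mult_right_mono) auto
          finally show ?thesis .
        qed
        have b2: "\<bar>\<Sum>j<J. U i j * V i j * (\<Sum>y\<in>Sf. v i y * f' j y)\<bar> \<le> real J * (K * (L * (C * r)))"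
        proof -
          have "\<bar>\<Sum>j<J. U i j * V i j * (\<Sum>y\<in>Sf. v i y * f' j y)\<bar> \<le> (\<Sum>j<J. K * (L * (C * r)))"
          proof (intro order_trans[OF sum_abs] sum_mono)
            fix j assume "j \<in> {..<J}"
            then show "\<bar>U i j * V i j * (\<Sum>y\<in>Sf. v i y * f' j y)\<bar> \<le> K * (L * (C * r))"
              using UV[OF i] vf K0 unfolding abs_mult[of "U i j * V i j"] by (intro mult_mono) auto
          qed
          then show ?thesis by simp
        qed
        have "1 \<le> L * (K * r) + real J * (K * (L * (C * r)))" using eq b1 b2 by linarith
        also have "\<dots> = D * r" by (simp add: D_def algebra_simps)
        also have "\<dots> \<le> D * (1 / (2 * (D + 1)))" using r D by (rule mult_left_mono)
        also have "\<dots> < 1" using D by (simp add: field_simps)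
        finally show False by simp
      qed
    qed
    have "\<tau> ` {..<J} = {..<J}" using surj \<tau> by auto
    then have "bij_betw \<tau> {..<J} {..<J}"
      by (simp add: bij_betw_def eq_card_imp_inj_on)
    then show "\<exists>\<tau>. bij_betw \<tau> {..<J} {..<J} \<and> (\<forall>j<J. \<forall>y. \<bar>f' j y - f (\<tau> j) y\<bar> \<le> C * r)"
      using close by blast
  qed
qed

section \<open>The law of the observations\<close>

text \<open>The backward recursion: likelihood of the list given that its first hidden state is
  \<open>i\<close>. At the last observation the remaining factor is a row sum of \<open>Q\<close>,
  which is 1 for a stochastic matrix.\<close>

fun lik :: "nat \<Rightarrow> (nat \<Rightarrow> nat \<Rightarrow> real) \<Rightarrow> (nat \<Rightarrow> int \<Rightarrow> real) \<Rightarrow> int list \<Rightarrow> nat \<Rightarrow> real" where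
  "lik J Q f [] i = 1"
| "lik J Q f (x # xs) i = f i x * (\<Sum>k<J. Q i k * lik J Q f xs k)"

text \<open>The same recursion with time-dependent weights \<open>c n i\<close>, started at time
  \<open>n\<close> and run for \<open>m\<close> steps; emission masses of sets as weights give
  conditional probabilities of cylinders.\<close>

fun path_weight :: "nat \<Rightarrow> (nat \<Rightarrow> nat \<Rightarrow> real) \<Rightarrow> (nat \<Rightarrow> nat \<Rightarrow> real) \<Rightarrow> nat \<Rightarrow> nat \<Rightarrow> nat \<Rightarrow> real" where
  "path_weight J Q c n 0 i = 1"
| "path_weight J Q c n (Suc m) i = c n i * (\<Sum>k<J. Q i k * path_weight J Q c (Suc n) m k)"

lemma sum_state_lists_Cons:
  "(\<Sum>\<theta>\<in>{\<theta>. length \<theta> = Suc n \<and> set \<theta> \<subseteq> {..<J}}. g \<theta>)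
    = (\<Sum>i<J. \<Sum>\<theta>\<in>{\<theta>. length \<theta> = n \<and> set \<theta> \<subseteq> {..<J}}. g (i # \<theta>))" (is "sum g ?A = _")
proof -
  have eq: "?A = (\<lambda>(i, \<theta>). i # \<theta>) ` ({..<J} \<times> {\<theta>. length \<theta> = n \<and> set \<theta> \<subseteq> {..<J}})"
    by (auto simp: length_Suc_conv image_iff)
  show ?thesis unfolding eq
    by (subst sum.reindex) (auto simp: inj_on_def sum.cartesian_product split_def intro!: sum.cong)
qed

text \<open>The initial weights \<open>q\<close> are arbitrary because, once the first state is
  \<open>i\<close>, the row \<open>Q i\<close> takes their place for the tail.\<close>

lemma sum_paths_eq_lik:
  assumes "stoch_matrix J Q" "xs \<noteq> []"
  shows "(\<Sum>\<theta>\<in>{\<theta>. length \<theta> = length xs \<and> set \<theta> \<subseteq> {..<J}}.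
      q (\<theta> ! 0) * (\<Prod>n<length xs - 1. Q (\<theta> ! n) (\<theta> ! Suc n)) * (\<Prod>n<length xs. f (\<theta> ! n) (xs ! n)))
    = (\<Sum>i<J. q i * lik J Q f xs i)"
  using assms(2)
proof (induction xs arbitrary: q)
  case (Cons x xs)
  show ?case
  proof (cases "xs = []")
    case True
    have "{\<theta>. length \<theta> = 0 \<and> set \<theta> \<subseteq> {..<J}} = {[]}" by auto
    moreover have "(\<Sum>k<J. Q i k) = 1" if "i < J" for i using assms(1) that by (simp add: stoch_matrix_def)
    ultimately show ?thesis
      using True by (simp only: list.size add_0_right sum_state_lists_Cons add_Suc_right) simp
  next
    case False
    then obtain y ys where ys: "xs = y # ys" by (cases xs) auto
    have "(\<Sum>\<theta>\<in>{\<theta>. length \<theta> = length (x # xs) \<and> set \<theta> \<subseteq> {..<J}}.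
      q (\<theta> ! 0) * (\<Prod>n<length (x # xs) - 1. Q (\<theta> ! n) (\<theta> ! Suc n)) * (\<Prod>n<length (x # xs). f (\<theta> ! n) ((x # xs) ! n)))
      = (\<Sum>i<J. \<Sum>\<theta>\<in>{\<theta>. length \<theta> = length xs \<and> set \<theta> \<subseteq> {..<J}}. q i * f i x *
       (Q i (\<theta> ! 0) * (\<Prod>n<length xs - 1. Q (\<theta> ! n) (\<theta> ! Suc n)) * (\<Prod>n<length xs. f (\<theta> ! n) (xs ! n))))"
      unfolding length_Cons sum_state_lists_Cons
      by (simp add: prod.lessThan_Suc_shift ys del: prod.lessThan_Suc) (simp add: ac_simps)
    also have "\<dots> = (\<Sum>i<J. q i * f i x * (\<Sum>k<J. Q i k * lik J Q f xs k))"
      unfolding sum_distrib_left[symmetric] using Cons.IH[OF False] by simp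
    finally show ?thesis by (simp add: mult.assoc)
  qed
qed simp

lemma has_sum_finite_sum:
  fixes g :: "'i \<Rightarrow> 'a \<Rightarrow> real"
  assumes "\<And>i. i \<in> I \<Longrightarrow> (g i has_sum s i) A"
  shows "((\<lambda>x. \<Sum>i\<in>I. g i x) has_sum (\<Sum>i\<in>I. s i)) A"
  using assms by (induction I rule: infinite_finite_induct) (auto intro: has_sum_add has_sum_0)

section \<open>Cylinder probabilities in a fixed model\<close>

locale hmm =
  fixes J :: nat and Q :: "nat \<Rightarrow> nat \<Rightarrow> real" and p :: "nat \<Rightarrow> real" and f :: "nat \<Rightarrow> int \<Rightarrow> real"
  assumes A2: "A2' J Q p" and A3: "A3 J f"
begin

lemma
  shows stoch: "stoch_matrix J Q" and irred: "irreducible_chain J Q" and inv: "invariant_dist J Q p"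
  using A2 by (auto simp: A2'_def)

lemma Q_nonneg: "i < J \<Longrightarrow> k < J \<Longrightarrow> Q i k \<ge> 0"
  and Q_sum: "i < J \<Longrightarrow> (\<Sum>k<J. Q i k) = 1"
  using stoch by (auto simp: stoch_matrix_def)

lemma p_nonneg: "i < J \<Longrightarrow> p i \<ge> 0" and p_sum: "(\<Sum>i<J. p i) = 1"
  and p_inv: "k < J \<Longrightarrow> (\<Sum>i<J. p i * Q i k) = p k"
  using inv by (auto simp: invariant_dist_def prob_vec_def)

lemma f_nonneg: "i < J \<Longrightarrow> f i x \<ge> 0" and f_sum: "i < J \<Longrightarrow> (f i has_sum 1) UNIV"
  using A3 by (auto simp: A3_def emission_pmfs_def)

lemma f_summable: "i < J \<Longrightarrow> f i summable_on S"
  using f_sum summable_on_subset_banach by (metis has_sum_imp_summable subset_UNIV)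

lemma hmm_prob_eq_lik: "hmm_prob J Q p f xs = (\<Sum>i<J. p i * lik J Q f xs i)"
  using sum_paths_eq_lik[OF stoch] p_sum by (auto simp: hmm_prob_def)

lemma lik_nonneg: "i < J \<Longrightarrow> lik J Q f xs i \<ge> 0"
  by (induction xs arbitrary: i) (auto intro!: mult_nonneg_nonneg sum_nonneg f_nonneg Q_nonneg)

lemma hmm_prob_nonneg: "hmm_prob J Q p f xs \<ge> 0"
  unfolding hmm_prob_eq_lik by (intro sum_nonneg mult_nonneg_nonneg p_nonneg lik_nonneg) auto

definition emass :: "int set \<Rightarrow> nat \<Rightarrow> real" where
  "emass S i = infsum (f i) S"

text \<open>Fubini on head and tail of the list; nonnegativity supplies summability on the product.
  The time offset \<open>a\<close> shifts by one with each head removed.\<close>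

lemma has_sum_lik:
  assumes "i < J"
  shows "((\<lambda>xs. lik J Q f xs i) has_sum path_weight J Q (\<lambda>n. emass (S n)) a m i)
    {xs. length xs = m \<and> (\<forall>n<m. xs ! n \<in> S (a + n))}"
  using assms
proof (induction m arbitrary: a i)
  case 0
  have "{xs. length xs = 0 \<and> (\<forall>n<0. xs ! n \<in> S (a + n))} = {[]}" by auto
  then show ?case using has_sum_finite[of "{[]}" "\<lambda>xs. lik J Q f xs i"] by simp
next
  case (Suc m)
  define B where "B = {xs. length xs = m \<and> (\<forall>n<m. xs ! n \<in> S (Suc a + n))}"
  define g where "g xs = (\<Sum>k<J. Q i k * lik J Q f xs k)" for xs
  define G where "G = (\<Sum>k<J. Q i k * path_weight J Q (\<lambda>n. emass (S n)) (Suc a) m k)"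
  have g: "(g has_sum G) B"
    unfolding g_def G_def B_def using Suc.IH[where a = "Suc a"]
    by (intro has_sum_finite_sum has_sum_cmult_right) auto
  have 1: "((\<lambda>xs. f i x * g xs) has_sum (f i x * G)) B" for x
    using g by (rule has_sum_cmult_right)
  have 2: "((\<lambda>x. f i x * G) has_sum (emass (S a) i * G)) (S a)"
    unfolding emass_def using f_summable[OF Suc.prems]
    by (intro has_sum_cmult_left has_sum_infsum)
  have "((\<lambda>(x, xs). f i x * g xs) has_sum (emass (S a) i * G)) (S a \<times> B)"
  proof (rule has_sum_SigmaI)
    show "(\<lambda>(x, xs). f i x * g xs) summable_on S a \<times> B"
      using 1 2 Suc.prems unfolding g_def
      by (intro summable_on_SigmaI[where g = "\<lambda>x. f i x * G"])
         (auto intro!: mult_nonneg_nonneg sum_nonneg f_nonneg Q_nonneg lik_nonneg dest: has_sum_imp_summable)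
  qed (use 1 2 in auto)
  also have "(\<lambda>(x, xs). f i x * g xs) = (\<lambda>xs. lik J Q f xs i) \<circ> (\<lambda>(x, xs). x # xs)"
    by (auto simp: g_def)
  finally have "((\<lambda>xs. lik J Q f xs i) has_sum (emass (S a) i * G)) ((\<lambda>(x, xs). x # xs) ` (S a \<times> B))"
    by (subst has_sum_reindex) (auto simp: inj_on_def comp_def)
  also have "(\<lambda>(x, xs). x # xs) ` (S a \<times> B)
      = {xs. length xs = Suc m \<and> (\<forall>n<Suc m. xs ! n \<in> S (a + n))}"
    by (auto simp: B_def length_Suc_conv image_iff All_less_Suc2)
  finally show ?case by (simp add: G_def)
qed

lemma has_sum_hmm_prob:
  "(hmm_prob J Q p f has_sum (\<Sum>i<J. p i * path_weight J Q (\<lambda>n. emass (S n)) 0 N i))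
    {xs. length xs = N \<and> (\<forall>n<N. xs ! n \<in> S n)}"
  unfolding hmm_prob_eq_lik[abs_def]
  using has_sum_lik[of _ N S 0] by (intro has_sum_finite_sum has_sum_cmult_right) auto

lemma emass_UNIV: "i < J \<Longrightarrow> emass UNIV i = 1"
  unfolding emass_def using f_sum by (auto intro: infsumI)

lemma emass_singleton: "emass {x} i = f i x"
  by (simp add: emass_def)

lemma emass_bounds: assumes "i < J" shows "0 \<le> emass S i" "emass S i \<le> 1"
proof -
  show "0 \<le> emass S i" unfolding emass_def using f_nonneg assms by (intro infsum_nonneg) auto
  have "emass S i \<le> emass UNIV i"
    unfolding emass_def using f_summable f_nonneg assms by (intro infsum_mono_neutral) auto
  then show "emass S i \<le> 1" using emass_UNIV assms by simp
qed

text \<open>Unconstrained times carry weight 1, so \<open>t\<close> of them collapse to a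
  \<open>t\<close>-step transition.\<close>

lemma path_weight_skip:
  assumes "\<And>n i. a \<le> n \<Longrightarrow> n < a + t \<Longrightarrow> i < J \<Longrightarrow> c n i = 1" "i < J"
  shows "path_weight J Q c a (t + m) i = (\<Sum>k<J. mpow J Q t i k * path_weight J Q c (a + t) m k)"
  using assms
proof (induction t arbitrary: m)
  case 0
  then show ?case by (simp add: if_distrib[of "\<lambda>t. t * _"] cong: if_cong)
next
  case (Suc t)
  have "path_weight J Q c a (Suc t + m) i = path_weight J Q c a (t + Suc m) i" by simp
  also have "\<dots> = (\<Sum>k<J. mpow J Q t i k * path_weight J Q c (a + t) (Suc m) k)"
    using Suc.prems by (intro Suc.IH) auto
  also have "\<dots> = (\<Sum>k<J. mpow J Q t i k * (\<Sum>l<J. Q k l * path_weight J Q c (a + Suc t) m l))"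
    using Suc.prems by (intro sum.cong) auto
  also have "\<dots> = (\<Sum>l<J. mpow J Q (Suc t) i l * path_weight J Q c (a + Suc t) m l)"
    by (simp add: sum_distrib_left sum_distrib_right mult.assoc) (rule sum.swap)
  finally show ?case .
qed

lemma path_weight_one:
  assumes "\<And>n i. a \<le> n \<Longrightarrow> n < a + m \<Longrightarrow> i < J \<Longrightarrow> c n i = 1" "i < J"
  shows "path_weight J Q c a m i = 1"
  using path_weight_skip[of a m c i 0] assms stoch_matrix_mpow[OF stoch, of m]
  by (simp add: stoch_matrix_def)

text \<open>Stationarity: an unconstrained initial stretch leaves the state distribution at
  \<open>p\<close>.\<close>

lemma sum_p_path_weight_skip:
  assumes "\<And>n i. n < t \<Longrightarrow> i < J \<Longrightarrow> c n i = 1"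
  shows "(\<Sum>i<J. p i * path_weight J Q c 0 (t + m) i) = (\<Sum>k<J. p k * path_weight J Q c t m k)"
proof -
  have "(\<Sum>i<J. p i * path_weight J Q c 0 (t + m) i)
    = (\<Sum>i<J. p i * (\<Sum>k<J. mpow J Q t i k * path_weight J Q c t m k))"
    using path_weight_skip[of 0 t c _ m] assms by (intro sum.cong) auto
  also have "\<dots> = (\<Sum>k<J. (\<Sum>i<J. p i * mpow J Q t i k) * path_weight J Q c t m k)"
    by (simp add: sum_distrib_left sum_distrib_right mult.assoc) (rule sum.swap)
  also have "\<dots> = (\<Sum>k<J. p k * path_weight J Q c t m k)"
    using invariant_mpow[of J p Q] p_inv by simp
  finally show ?thesis .
qed

section \<open>The observations as a probability mass function\<close>

definition data :: "nat \<Rightarrow> int list pmf" where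
  "data N = embed_pmf (\<lambda>xs. if length xs = N then hmm_prob J Q p f xs else 0)"

lemma hmm_prob_sum_1: "(hmm_prob J Q p f has_sum 1) {xs. length xs = N}"
proof -
  have "path_weight J Q (\<lambda>n. emass UNIV) 0 N i = 1" if "i < J" for i
    using that emass_UNIV by (intro path_weight_one)
  then show ?thesis using has_sum_hmm_prob[of N "\<lambda>_. UNIV"] p_sum by simp
qed

lemma pmf_data: "pmf (data N) xs = (if length xs = N then hmm_prob J Q p f xs else 0)"
  unfolding data_def
proof (rule pmf_embed_pmf)
  let ?h = "\<lambda>xs. if length xs = N then hmm_prob J Q p f xs else 0"
  have "(?h has_sum 1) UNIV"
    using hmm_prob_sum_1[of N]
    by (subst has_sum_cong_neutral[where T = "{xs. length xs = N}" and g = "hmm_prob J Q p f"]) auto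
  moreover from this have "Infinite_Sum.abs_summable_on ?h UNIV"
    using hmm_prob_nonneg by (auto dest!: has_sum_imp_summable)
  ultimately have "infsetsum ?h UNIV = 1" "Infinite_Set_Sum.abs_summable_on ?h UNIV"
    by (auto simp: infsetsum_infsum abs_summable_equivalent[symmetric] infsumI)
  then show "(\<integral>\<^sup>+xs. ennreal (?h xs) \<partial>count_space UNIV) = 1"
    using hmm_prob_nonneg by (subst nn_integral_conv_infsetsum) auto
qed (use hmm_prob_nonneg in auto)

text \<open>Identifies the infinite sum \<open>hmm_P\<close> with a probability measure, so that
  monotonicity, Markov's inequality and countable subadditivity become available.\<close>

lemma prob_data: "measure_pmf.prob (data N) {xs. A xs} = hmm_P J Q p f N A"
proof -
  have "Infinite_Set_Sum.abs_summable_on (pmf (data N)) {xs. A xs}" by (rule pmf_abs_summable)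
  then have "measure_pmf.prob (data N) {xs. A xs} = infsum (pmf (data N)) {xs. A xs}"
    by (simp add: measure_pmf_conv_infsetsum infsetsum_infsum)
  also have "\<dots> = infsum (hmm_prob J Q p f) {xs. length xs = N \<and> A xs}"
    by (intro infsum_cong_neutral) (auto simp: pmf_data)
  finally show ?thesis by (simp add: hmm_P_def)
qed

lemma prob_cylinder:
  "measure_pmf.prob (data N) {xs. \<forall>n<N. xs ! n \<in> S n} = (\<Sum>i<J. p i * path_weight J Q (\<lambda>n. emass (S n)) 0 N i)"
  unfolding prob_data hmm_P_def using has_sum_hmm_prob[of N S] by (rule infsumI)

end

section \<open>Variance of window frequencies\<close>

definition window :: "int set \<Rightarrow> int set \<Rightarrow> int set \<Rightarrow> nat \<Rightarrow> int list \<Rightarrow> bool" where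
  "window A B C t xs \<longleftrightarrow> xs ! t \<in> A \<and> xs ! Suc t \<in> B \<and> xs ! Suc (Suc t) \<in> C"

text \<open>A sample of size \<open>N\<close> contains \<open>N - 2\<close> windows of three
  consecutive observations, starting at \<open>0\<close> to \<open>N - 3\<close>.\<close>

definition freq :: "nat \<Rightarrow> int set \<Rightarrow> int set \<Rightarrow> int set \<Rightarrow> int list \<Rightarrow> real" where
  "freq N A B C xs = (\<Sum>t<N-2. of_bool (window A B C t xs)) / real (N - 2)"

lemma sum_mult_sum_swap:
  fixes c :: "'a \<Rightarrow> real"
  shows "(\<Sum>k\<in>K. c k * (\<Sum>l\<in>L. h k l * g l)) = (\<Sum>l\<in>L. (\<Sum>k\<in>K. c k * h k l) * g l)"
  by (simp add: sum_distrib_left sum_distrib_right mult.assoc) (rule sum.swap)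

lemma trilinear_sum_right:
  "trilinear J Q p a b (\<lambda>k. \<Sum>l\<in>L. c l k * g l) = (\<Sum>l\<in>L. trilinear J Q p a b (c l) * g l)"
proof -
  have 1: "(\<Sum>k<J. Q j k * (\<Sum>l\<in>L. c l k * g l)) = (\<Sum>l\<in>L. (\<Sum>k<J. Q j k * c l k) * g l)" for j
    by (rule sum_mult_sum_swap)
  have 2: "(\<Sum>j<J. Q i j * b j * (\<Sum>l\<in>L. (\<Sum>k<J. Q j k * c l k) * g l))
    = (\<Sum>l\<in>L. (\<Sum>j<J. Q i j * b j * (\<Sum>k<J. Q j k * c l k)) * g l)" for i
    by (rule sum_mult_sum_swap)
  show ?thesis unfolding trilinear_def 1 2 by (rule sum_mult_sum_swap)
qed

section \<open>Probabilities and covariances of windows\<close>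

context hmm
begin

definition wprob :: "int set \<Rightarrow> int set \<Rightarrow> int set \<Rightarrow> real" where
  "wprob A B C = trilinear J Q p (emass A) (emass B) (emass C)"

text \<open>Stationary probability that a window occurs and the state right after it is
  \<open>l\<close>. Its counterpart \<open>wentry\<close> is the probability of the window given its
  first state; together they decouple two disjoint windows.\<close>

definition wexit :: "int set \<Rightarrow> int set \<Rightarrow> int set \<Rightarrow> nat \<Rightarrow> real" where
  "wexit A B C l = trilinear J Q p (emass A) (emass B) (\<lambda>k. emass C k * Q k l)"

definition wentry :: "int set \<Rightarrow> int set \<Rightarrow> int set \<Rightarrow> nat \<Rightarrow> real" where
  "wentry A B C i = emass A i * (\<Sum>j<J. Q i j * emass B j * (\<Sum>k<J. Q j k * emass C k))"

lemma wprob_eq_entry: "wprob A B C = (\<Sum>i<J. p i * wentry A B C i)"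
  by (simp add: wprob_def trilinear_def wentry_def mult.assoc)

lemma wexit_nonneg: "l < J \<Longrightarrow> wexit A B C l \<ge> 0"
  unfolding wexit_def trilinear_def
  by (intro sum_nonneg mult_nonneg_nonneg p_nonneg Q_nonneg emass_bounds) auto

lemma wexit_sum: "(\<Sum>l<J. wexit A B C l) = wprob A B C"
proof -
  have "(\<Sum>l<J. wexit A B C l) = trilinear J Q p (emass A) (emass B) (\<lambda>k. emass C k * (\<Sum>l<J. Q k l))"
    using trilinear_sum_right[of J Q p "emass A" "emass B" "\<lambda>l k. emass C k * Q k l" "\<lambda>_. 1" "{..<J}"]
    by (simp add: wexit_def sum_distrib_left)
  also have "\<dots> = wprob A B C" by (simp add: wprob_def trilinear_def Q_sum)
  finally show ?thesis .
qed

lemma wentry_bounds: assumes "i < J" shows "0 \<le> wentry A B C i" "wentry A B C i \<le> 1"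
proof -
  show "0 \<le> wentry A B C i"
    unfolding wentry_def using assms by (intro sum_nonneg mult_nonneg_nonneg Q_nonneg emass_bounds) auto
  have avg: "(\<Sum>k<J. Q j k * g k) \<le> 1" if "j < J" "\<And>k. k < J \<Longrightarrow> g k \<le> 1" for j g
  proof -
    have "(\<Sum>k<J. Q j k * g k) \<le> (\<Sum>k<J. Q j k * 1)"
      using that Q_nonneg by (intro sum_mono mult_left_mono) auto
    then show ?thesis using Q_sum that by simp
  qed
  have C: "(\<Sum>k<J. Q j k * emass C k) \<le> 1" if "j < J" for j using that emass_bounds by (intro avg)
  have C0: "(\<Sum>k<J. Q j k * emass C k) \<ge> 0" if "j < J" for j
    using that emass_bounds Q_nonneg by (intro sum_nonneg mult_nonneg_nonneg) auto
  have "(\<Sum>j<J. Q i j * (emass B j * (\<Sum>k<J. Q j k * emass C k))) \<le> 1"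
    using assms emass_bounds C C0 by (intro avg mult_le_one) auto
  moreover have "(\<Sum>j<J. Q i j * (emass B j * (\<Sum>k<J. Q j k * emass C k))) \<ge> 0"
    using assms emass_bounds C0 Q_nonneg by (intro sum_nonneg mult_nonneg_nonneg) auto
  ultimately show "wentry A B C i \<le> 1"
    unfolding wentry_def using assms emass_bounds by (intro mult_le_one) (auto simp: mult.assoc)
qed

lemma wprob_nonneg: "0 \<le> wprob A B C"
  unfolding wprob_eq_entry using p_nonneg wentry_bounds by (intro sum_nonneg mult_nonneg_nonneg) auto

lemma path_weight_window_head:
  "(\<Sum>i<J. p i * path_weight J Q (\<lambda>n. emass (S n)) t (Suc (Suc (Suc m))) i)
    = (\<Sum>l<J. wexit (S t) (S (Suc t)) (S (Suc (Suc t))) l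
        * path_weight J Q (\<lambda>n. emass (S n)) (Suc (Suc (Suc t))) m l)"
proof -
  let ?w = "path_weight J Q (\<lambda>n. emass (S n)) (Suc (Suc (Suc t))) m"
  have "(\<Sum>l<J. wexit (S t) (S (Suc t)) (S (Suc (Suc t))) l * ?w l)
    = trilinear J Q p (emass (S t)) (emass (S (Suc t))) (\<lambda>k. \<Sum>l<J. emass (S (Suc (Suc t))) k * Q k l * ?w l)"
    unfolding wexit_def by (rule trilinear_sum_right[symmetric])
  also have "\<dots> = trilinear J Q p (emass (S t)) (emass (S (Suc t)))
      (\<lambda>k. emass (S (Suc (Suc t))) k * (\<Sum>l<J. Q k l * ?w l))"
    by (simp only: sum_distrib_left mult.assoc)
  finally show ?thesis by (simp add: trilinear_def mult.assoc)
qed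

lemma path_weight_window_tail:
  assumes "\<And>n. n \<ge> Suc (Suc (Suc t)) \<Longrightarrow> S n = UNIV" "i < J"
  shows "path_weight J Q (\<lambda>n. emass (S n)) t (Suc (Suc (Suc m))) i
    = wentry (S t) (S (Suc t)) (S (Suc (Suc t))) i"
proof -
  have "path_weight J Q (\<lambda>n. emass (S n)) (Suc (Suc (Suc t))) m l = 1" if "l < J" for l
    using that assms emass_UNIV by (intro path_weight_one) auto
  then show ?thesis using assms(2) by (simp add: wentry_def Q_sum mult.assoc)
qed

lemma prob_window:
  assumes "t + 3 \<le> N"
  shows "measure_pmf.prob (data N) {xs. window A B C t xs} = wprob A B C"
proof -
  define S where "S n = (if n = t then A else if n = Suc t then B else if n = Suc (Suc t) then C else UNIV)" for n
  obtain m where N: "N = t + Suc (Suc (Suc m))" using assms by (auto simp: le_iff_add)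
  have "{xs. window A B C t xs} = {xs. \<forall>n<N. xs ! n \<in> S n}"
  proof (intro Collect_cong iffI allI impI)
    fix xs n assume "window A B C t xs"
    then show "xs ! n \<in> S n" by (auto simp: window_def S_def)
  next
    fix xs assume *: "\<forall>n<N. xs ! n \<in> S n"
    then show "window A B C t xs"
      using assms *[rule_format, of t] *[rule_format, of "Suc t"] *[rule_format, of "Suc (Suc t)"]
      by (simp add: window_def S_def)
  qed
  then have "measure_pmf.prob (data N) {xs. window A B C t xs}
    = (\<Sum>i<J. p i * path_weight J Q (\<lambda>n. emass (S n)) 0 N i)"
    by (simp add: prob_cylinder)
  also have "\<dots> = (\<Sum>i<J. p i * path_weight J Q (\<lambda>n. emass (S n)) t (Suc (Suc (Suc m))) i)"
    unfolding N by (rule sum_p_path_weight_skip) (simp add: S_def emass_UNIV)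
  also have "\<dots> = (\<Sum>i<J. p i * wentry A B C i)"
    by (intro sum.cong refl, subst path_weight_window_tail) (auto simp: S_def)
  finally show ?thesis by (simp add: wprob_eq_entry)
qed

text \<open>\<open>r\<close> counts the unconstrained observations between the windows. By the
  Markov property the first window influences the second only through the state following it, which
  moves by \<open>r\<close> transitions to the start of the second.\<close>

lemma prob_two_windows:
  assumes "t + 3 + r + 3 \<le> N"
  shows "measure_pmf.prob (data N) {xs. window A B C t xs \<and> window A B C (t + 3 + r) xs}
    = (\<Sum>l<J. wexit A B C l * (\<Sum>m<J. mpow J Q r l m * wentry A B C m))"
proof -
  define s where "s = t + 3 + r"
  define S where "S n = (if n = t \<or> n = s then A else if n = Suc t \<or> n = Suc s then B
    else if n = Suc (Suc t) \<or> n = Suc (Suc s) then C else UNIV)" for n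
  obtain m where N: "N = t + Suc (Suc (Suc (r + Suc (Suc (Suc m)))))" using assms by (auto simp: le_iff_add)
  have s: "s = Suc (Suc (Suc t)) + r" by (simp add: s_def)
  have "{xs. window A B C t xs \<and> window A B C s xs} = {xs. \<forall>n<N. xs ! n \<in> S n}"
  proof (intro Collect_cong iffI allI impI)
    fix xs n assume "window A B C t xs \<and> window A B C s xs"
    then show "xs ! n \<in> S n" by (auto simp: window_def S_def)
  next
    fix xs assume *: "\<forall>n<N. xs ! n \<in> S n"
    have "S t = A" "S (Suc t) = B" "S (Suc (Suc t)) = C" "S s = A" "S (Suc s) = B" "S (Suc (Suc s)) = C"
      by (simp_all add: S_def s_def)
    then show "window A B C t xs \<and> window A B C s xs"
      using assms *[rule_format, of t] *[rule_format, of "Suc t"] *[rule_format, of "Suc (Suc t)"]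
        *[rule_format, of s] *[rule_format, of "Suc s"] *[rule_format, of "Suc (Suc s)"]
      by (simp add: window_def s_def)
  qed
  then have "measure_pmf.prob (data N) {xs. window A B C t xs \<and> window A B C s xs}
    = (\<Sum>i<J. p i * path_weight J Q (\<lambda>n. emass (S n)) 0 N i)"
    by (simp add: prob_cylinder)
  also have "\<dots> = (\<Sum>i<J. p i * path_weight J Q (\<lambda>n. emass (S n)) t (Suc (Suc (Suc (r + Suc (Suc (Suc m)))))) i)"
    unfolding N by (rule sum_p_path_weight_skip) (simp add: S_def s_def emass_UNIV)
  also have "\<dots> = (\<Sum>l<J. wexit A B C l
        * path_weight J Q (\<lambda>n. emass (S n)) (Suc (Suc (Suc t))) (r + Suc (Suc (Suc m))) l)"
    unfolding path_weight_window_head by (simp add: S_def s_def)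
  also have "\<dots> = (\<Sum>l<J. wexit A B C l * (\<Sum>m<J. mpow J Q r l m * wentry A B C m))"
  proof (intro sum.cong refl arg_cong2[where f = "(*)"])
    fix l assume l: "l \<in> {..<J}"
    have "path_weight J Q (\<lambda>n. emass (S n)) (Suc (Suc (Suc t))) (r + Suc (Suc (Suc m))) l
      = (\<Sum>k<J. mpow J Q r l k * path_weight J Q (\<lambda>n. emass (S n)) s (Suc (Suc (Suc m))) k)"
      unfolding s using l by (intro path_weight_skip) (auto simp: S_def s_def emass_UNIV)
    also have "\<dots> = (\<Sum>k<J. mpow J Q r l k * wentry A B C k)"
      by (intro sum.cong refl, subst path_weight_window_tail) (auto simp: S_def s_def)
    finally show "path_weight J Q (\<lambda>n. emass (S n)) (Suc (Suc (Suc t))) (r + Suc (Suc (Suc m))) l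
      = (\<Sum>m<J. mpow J Q r l m * wentry A B C m)" .
  qed
  finally show ?thesis by (simp add: s_def)
qed

text \<open>Overlapping windows are handled by \<open>P(E \<inter> F) \<le> P(F)\<close>.\<close>

fun cov_bound :: "int set \<Rightarrow> int set \<Rightarrow> int set \<Rightarrow> nat \<Rightarrow> real" where
  "cov_bound A B C 0 = wprob A B C"
| "cov_bound A B C (Suc 0) = wprob A B C"
| "cov_bound A B C (Suc (Suc r)) = (\<Sum>l<J. wexit A B C l * (\<Sum>m<J. (mpow J Q r l m - p m) * wentry A B C m))"

lemma covariance_le:
  assumes "t < s" "s + 3 \<le> N"
  shows "measure_pmf.prob (data N) {xs. window A B C t xs \<and> window A B C s xs} - (wprob A B C)\<^sup>2
    \<le> cov_bound A B C (s - Suc t)"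
proof -
  have "measure_pmf.prob (data N) {xs. window A B C t xs \<and> window A B C s xs}
    \<le> measure_pmf.prob (data N) {xs. window A B C s xs}"
    by (intro measure_pmf.finite_measure_mono) auto
  then have near: "measure_pmf.prob (data N) {xs. window A B C t xs \<and> window A B C s xs} - (wprob A B C)\<^sup>2 \<le> wprob A B C"
    using prob_window[OF assms(2), of A B C] zero_le_power2[of "wprob A B C"] by linarith
  \<comment> \<open>Start times at distance 1 or 2 give overlapping windows; from distance 3 on the
    exact two-window formula applies with \<open>r\<close> unconstrained positions.\<close>
  consider "s - Suc t = 0" | "s - Suc t = Suc 0" | r where "s - Suc t = Suc (Suc r)"
    by (metis not0_implies_Suc)
  then show ?thesis
  proof cases
    case (3 r)
    then have s: "s = t + 3 + r" using assms by simp
    have "(wprob A B C)\<^sup>2 = (\<Sum>l<J. wexit A B C l * (\<Sum>m<J. p m * wentry A B C m))"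
      by (simp add: sum_distrib_right[symmetric] wexit_sum wprob_eq_entry[symmetric] power2_eq_square)
    then show ?thesis using assms unfolding 3 s
      by (subst prob_two_windows) (auto simp: sum_subtractf left_diff_distrib right_diff_distrib)
  qed (use near in auto)
qed

text \<open>The sum over lags is taken before absolute values, so the bounded partial sums of powers
  of \<open>Q\<close> apply. The factors \<open>wexit\<close> add up to \<open>wprob\<close>, which
  makes the bound proportional to the probability of the window.\<close>

lemma sum_cov_bound_le:
  "\<exists>K\<ge>0. \<forall>A B C s. (\<Sum>u<s. cov_bound A B C u) \<le> K * wprob A B C"
proof -
  obtain D where D: "D \<ge> 0" "\<And>n i k. i < J \<Longrightarrow> k < J \<Longrightarrow> \<bar>\<Sum>r<n. (mpow J Q r i k - p k)\<bar> \<le> D"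
    using sum_mpow_bounded[OF stoch irred inv] by blast
  have far: "(\<Sum>r<n. cov_bound A B C (Suc (Suc r))) \<le> real J * D * wprob A B C" for n A B C
  proof -
    have "(\<Sum>r<n. cov_bound A B C (Suc (Suc r)))
      = (\<Sum>l<J. wexit A B C l * (\<Sum>m<J. (\<Sum>r<n. (mpow J Q r l m - p m)) * wentry A B C m))"
      unfolding cov_bound.simps
      by (subst sum.swap, intro sum.cong refl, subst sum_distrib_left[symmetric],
          subst sum.swap, simp only: sum_distrib_right)
    also have "\<dots> \<le> (\<Sum>l<J. wexit A B C l * (\<Sum>m<J. D * 1))"
    proof (intro sum_mono mult_left_mono)
      fix l m assume lm: "l \<in> {..<J}" "m \<in> {..<J}"
      have "(\<Sum>r<n. (mpow J Q r l m - p m)) * wentry A B C m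
        \<le> \<bar>\<Sum>r<n. (mpow J Q r l m - p m)\<bar> * wentry A B C m"
        using wentry_bounds lm by (intro mult_right_mono) auto
      also have "\<dots> \<le> D * 1" using wentry_bounds lm D by (intro mult_mono) auto
      finally show "(\<Sum>r<n. (mpow J Q r l m - p m)) * wentry A B C m \<le> D * 1" .
    qed (use wexit_nonneg in auto)
    also have "\<dots> = real J * D * wprob A B C"
      by (simp add: sum_distrib_right[symmetric] wexit_sum)
    finally show ?thesis .
  qed
  have "(\<Sum>u<s. cov_bound A B C u) \<le> (2 + real J * D) * wprob A B C" for A B C s
  proof -
    have "(\<Sum>u<s. cov_bound A B C u) \<le> 2 * wprob A B C + real J * D * wprob A B C"
    proof (cases "s \<le> 1")
      case True
      then have "(\<Sum>u<s. cov_bound A B C u) \<le> wprob A B C"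
        using wprob_nonneg by (cases s) auto
      then show ?thesis using far[of A B C 0] wprob_nonneg[of A B C] by auto
    next
      case False
      then obtain n where s: "s = Suc (Suc n)"
        by (metis One_nat_def Suc_le_D not_less_eq_eq)
      have "(\<Sum>u<s. cov_bound A B C u) = wprob A B C + (wprob A B C + (\<Sum>r<n. cov_bound A B C (Suc (Suc r))))"
        unfolding s sum.lessThan_Suc_shift by simp
      then show ?thesis using far[of A B C n] by simp
    qed
    then show ?thesis by (simp add: algebra_simps)
  qed
  then show ?thesis using D by (intro exI[of _ "2 + real J * D"]) auto
qed

lemma second_moment_freq:
  "\<exists>K\<ge>0. \<forall>A B C n. measure_pmf.expectation (data (n + 2)) (\<lambda>xs. (\<Sum>t<n. of_bool (window A B C t xs) - wprob A B C)\<^sup>2)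
     \<le> real n * (K * wprob A B C)"
proof -
  obtain K where K: "K \<ge> 0" "\<And>A B C s. (\<Sum>u<s. cov_bound A B C u) \<le> K * wprob A B C"
    using sum_cov_bound_le by blast
  have "measure_pmf.expectation (data (n + 2)) (\<lambda>xs. (\<Sum>t<n. of_bool (window A B C t xs) - wprob A B C)\<^sup>2)
     \<le> real n * ((1 + 2 * K) * wprob A B C)" for A B C n
  proof -
    let ?M = "data (n + 2)"
    define q where "q = wprob A B C"
    define Y where "Y t xs = (of_bool (window A B C t xs) - q :: real)" for t xs
    have int: "integrable ?M g" if "\<And>xs. \<bar>g xs\<bar> \<le> b" for g :: "int list \<Rightarrow> real" and b
      using that by (intro measure_pmf.integrable_const_bound[where B = b]) auto
    have ev: "measure_pmf.expectation ?M (\<lambda>xs. of_bool (P xs)) = measure_pmf.prob ?M {xs. P xs}" for P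
    proof -
      have "(\<lambda>xs. of_bool (P xs) :: real) = indicator {xs. P xs}" by (auto simp: indicator_def)
      then show ?thesis by simp
    qed
    have c: "measure_pmf.expectation ?M (\<lambda>xs. Y t xs * Y s xs)
      = measure_pmf.prob ?M {xs. window A B C t xs \<and> window A B C s xs} - q\<^sup>2" if "t < n" "s < n" for t s
    proof -
      have "(\<lambda>xs. Y t xs * Y s xs) = (\<lambda>xs. of_bool (window A B C t xs \<and> window A B C s xs)
          - q * of_bool (window A B C t xs) - q * of_bool (window A B C s xs) + q\<^sup>2)"
        by (auto simp: Y_def power2_eq_square algebra_simps)
      moreover have "integrable ?M (\<lambda>xs. of_bool (P xs) :: real)" for P by (rule int[of _ 1]) auto
      ultimately have "measure_pmf.expectation ?M (\<lambda>xs. Y t xs * Y s xs)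
        = measure_pmf.prob ?M {xs. window A B C t xs \<and> window A B C s xs} - q * q - q * q + q\<^sup>2"
        using that by (simp add: ev prob_window q_def del: add_2_eq_Suc add_2_eq_Suc')
      then show ?thesis by (simp add: power2_eq_square)
    qed
    have intY: "integrable ?M (\<lambda>xs. Y t xs * Y s xs)" for t s
    proof (rule int[of _ "(1 + \<bar>q\<bar>) * (1 + \<bar>q\<bar>)"])
      show "\<bar>Y t xs * Y s xs\<bar> \<le> (1 + \<bar>q\<bar>) * (1 + \<bar>q\<bar>)" for xs
        unfolding abs_mult by (intro mult_mono) (auto simp: Y_def)
    qed
    have sq: "measure_pmf.expectation ?M (\<lambda>xs. (\<Sum>t<m. Y t xs)\<^sup>2)
      = (\<Sum>t<m. \<Sum>s<m. measure_pmf.expectation ?M (\<lambda>xs. Y t xs * Y s xs))" for m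
      by (simp add: power2_eq_square sum_product intY del: add_2_eq_Suc add_2_eq_Suc')
    \<comment> \<open>Induction on the size of the covariance matrix: a new row and column
      contribute twice a covariance sum, at most \<open>2 * K * q\<close>, and one variance, at most
      \<open>q\<close>. Hence the constant \<open>1 + 2 * K\<close>.\<close>
    have "(\<Sum>t<m. \<Sum>s<m. measure_pmf.expectation ?M (\<lambda>xs. Y t xs * Y s xs)) \<le> real m * ((1 + 2 * K) * q)"
      if "m \<le> n" for m
      using that
    proof (induction m)
      case (Suc m)
      define e where "e t s = measure_pmf.expectation ?M (\<lambda>xs. Y t xs * Y s xs)" for t s
      have "(\<Sum>t<m. e m t) = (\<Sum>t<m. e t m)" by (simp add: e_def mult.commute)
      then have "(\<Sum>t<Suc m. \<Sum>s<Suc m. e t s) = (\<Sum>t<m. \<Sum>s<m. e t s) + 2 * (\<Sum>t<m. e t m) + e m m"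
        by (simp add: sum.distrib)
      moreover have "(\<Sum>t<m. e t m) \<le> K * q"
      proof -
        have "(\<Sum>t<m. e t m) \<le> (\<Sum>t<m. cov_bound A B C (m - Suc t))"
          unfolding e_def using Suc.prems c covariance_le[of _ m "n + 2" A B C]
          by (intro sum_mono) (auto simp: q_def)
        also have "\<dots> = (\<Sum>u<m. cov_bound A B C u)" by (rule sum.nat_diff_reindex)
        finally show ?thesis using K(2)[of A B C m] by (simp add: q_def)
      qed
      moreover have "e m m \<le> q"
        unfolding e_def using c[of m m] Suc.prems prob_window[of m "n + 2" A B C] by (simp add: q_def)
      moreover have "(\<Sum>t<m. \<Sum>s<m. e t s) \<le> real m * ((1 + 2 * K) * q)"
        using Suc by (simp add: e_def)
      ultimately show ?case unfolding e_def[symmetric] by (simp add: algebra_simps)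
    qed simp
    then show ?thesis using sq by (simp add: Y_def q_def)
  qed
  then show ?thesis using K by (intro exI[of _ "1 + 2 * K"]) auto
qed

text \<open>Chebyshev's inequality, keeping the factor \<open>wprob A B C\<close> that makes the
  bounds summable over disjoint windows.\<close>

lemma prob_freq_deviation:
  "\<exists>K\<ge>0. \<forall>A B C N r. N \<ge> 3 \<longrightarrow> r > 0 \<longrightarrow>
    measure_pmf.prob (data N) {xs. \<bar>freq N A B C xs - wprob A B C\<bar> > r} \<le> K / (real (N - 2) * r\<^sup>2) * wprob A B C"
proof -
  obtain K where K: "K \<ge> 0" "\<And>A B C n. measure_pmf.expectation (data (n + 2))
      (\<lambda>xs. (\<Sum>t<n. of_bool (window A B C t xs) - wprob A B C)\<^sup>2) \<le> real n * (K * wprob A B C)"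
    using second_moment_freq by blast
  have "measure_pmf.prob (data N) {xs. \<bar>freq N A B C xs - wprob A B C\<bar> > r} \<le> K / (real (N - 2) * r\<^sup>2) * wprob A B C"
    if N: "N \<ge> 3" and r: "r > 0" for N r A B C
  proof -
    define n where "n = N - 2"
    have Nn: "N = n + 2" and n: "n > 0" using N by (auto simp: n_def)
    define Z where "Z xs = (\<Sum>t<n. of_bool (window A B C t xs) - wprob A B C)" for xs
    have Z: "Z xs = real n * (freq N A B C xs - wprob A B C)" for xs
      using n by (simp add: Z_def freq_def n_def[symmetric] sum_subtractf right_diff_distrib)
    have Zb: "\<bar>Z xs\<bar> \<le> real n * (1 + \<bar>wprob A B C\<bar>)" for xs
    proof -
      have "\<bar>Z xs\<bar> \<le> (\<Sum>t<n. 1 + \<bar>wprob A B C\<bar>)"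
        unfolding Z_def by (intro order_trans[OF sum_abs] sum_mono) auto
      then show ?thesis by simp
    qed
    have "measure_pmf.prob (data N) {xs. \<bar>freq N A B C xs - wprob A B C\<bar> > r}
      \<le> measure_pmf.prob (data N) {xs \<in> space (data N). (Z xs)\<^sup>2 \<ge> (real n * r)\<^sup>2}"
    proof (intro measure_pmf.finite_measure_mono subsetI)
      fix xs assume "xs \<in> {xs. \<bar>freq N A B C xs - wprob A B C\<bar> > r}"
      then have "real n * r \<le> \<bar>Z xs\<bar>" using n by (simp add: Z abs_mult)
      then show "xs \<in> {xs \<in> space (data N). (Z xs)\<^sup>2 \<ge> (real n * r)\<^sup>2}"
        using r by (auto simp: abs_le_square_iff[symmetric])
    qed auto
    also have "\<dots> \<le> measure_pmf.expectation (data N) (\<lambda>xs. (Z xs)\<^sup>2) / (real n * r)\<^sup>2"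
    proof (rule integral_Markov_inequality_measure[where A = "{}"])
      have "\<bar>(Z xs)\<^sup>2\<bar> \<le> (real n * (1 + \<bar>wprob A B C\<bar>))\<^sup>2" for xs
        using Zb[of xs] by (simp add: abs_le_square_iff[symmetric] abs_mult)
      then show "integrable (data N) (\<lambda>xs. (Z xs)\<^sup>2)"
        by (intro measure_pmf.integrable_const_bound) auto
    qed (use n r in auto)
    also have "\<dots> \<le> (real n * (K * wprob A B C)) / (real n * r)\<^sup>2"
      using K(2)[of n A B C] n r by (intro divide_right_mono) (auto simp: Z_def Nn)
    also have "\<dots> = K / (real (N - 2) * r\<^sup>2) * wprob A B C"
      using n r by (simp add: n_def[symmetric] power2_eq_square field_simps)
    finally show ?thesis .
  qed
  then show ?thesis using K(1) by blast
qed

text \<open>Disjoint windows have total probability at most 1, so the variances of countably many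
  frequencies can be summed in a union bound.\<close>

lemma prob_uniform_freq_deviation:
  fixes A B C :: "'i \<Rightarrow> int set"
  assumes K: "K \<ge> 0" "\<And>A B C N r. N \<ge> 3 \<Longrightarrow> r > 0 \<Longrightarrow>
      measure_pmf.prob (data N) {xs. \<bar>freq N A B C xs - wprob A B C\<bar> > r} \<le> K / (real (N - 2) * r\<^sup>2) * wprob A B C"
    and cnt: "countable (UNIV :: 'i set)" "infinite (UNIV :: 'i set)"
    and disj: "\<And>i j xs. window (A i) (B i) (C i) 0 xs \<Longrightarrow> window (A j) (B j) (C j) 0 xs \<Longrightarrow> i = j"
    and N: "N \<ge> 3" and r: "r > 0"
  shows "measure_pmf.prob (data N) {xs. \<exists>i. \<bar>freq N (A i) (B i) (C i) xs - wprob (A i) (B i) (C i)\<bar> > r}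
    \<le> K / (real (N - 2) * r\<^sup>2)"
proof -
  \<comment> \<open>Enumerating the infinite countable index type by the natural numbers turns the
    union bound into a series.\<close>
  define e where "e = from_nat_into (UNIV :: 'i set)"
  have e: "bij e" unfolding e_def using bij_betw_from_nat_into[OF cnt] by simp
  define q where "q n = wprob (A (e n)) (B (e n)) (C (e n))" for n
  define E where "E n = {xs. \<bar>freq N (A (e n)) (B (e n)) (C (e n)) xs - q n\<bar> > r}" for n
  define W where "W n = {xs. window (A (e n)) (B (e n)) (C (e n)) 0 xs}" for n
  have "disjoint_family W"
  proof (unfold disjoint_family_on_def, intro ballI impI)
    fix m n :: nat assume "m \<noteq> n"
    then have "e m \<noteq> e n" using bij_is_inj[OF e] by (simp add: inj_eq)
    then show "W m \<inter> W n = {}" using disj[of "e m" _ "e n"] by (auto simp: W_def)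
  qed
  \<comment> \<open>Samples of length 3 contain a single window, so the probabilities
    \<open>q n\<close> are those of disjoint events in one probability space.\<close>
  then have "(\<lambda>n. measure_pmf.prob (data 3) (W n)) sums measure_pmf.prob (data 3) (\<Union>n. W n)"
    by (intro measure_pmf.finite_measure_UNION) auto
  moreover have "measure_pmf.prob (data 3) (W n) = q n" for n
    by (simp add: W_def q_def prob_window)
  ultimately have q: "summable q" "suminf q \<le> 1"
    by (auto simp: sums_iff)
  define b where "b = K / (real (N - 2) * r\<^sup>2)"
  have b: "b \<ge> 0" using K by (simp add: b_def)
  have Eq: "measure_pmf.prob (data N) (E n) \<le> b * q n" for n
    unfolding E_def q_def b_def using K(2) N r by blast
  have sE: "summable (\<lambda>n. measure_pmf.prob (data N) (E n))"
    by (rule summable_comparison_test'[where g = "\<lambda>n. b * q n"]) (use Eq q in auto)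
  have "{xs. \<exists>i. \<bar>freq N (A i) (B i) (C i) xs - wprob (A i) (B i) (C i)\<bar> > r} = (\<Union>n. E n)"
  proof -
    have "(\<exists>i. R i) \<longleftrightarrow> (\<exists>n. R (e n))" for R using bij_is_surj[OF e] by (metis surjD)
    from this[of "\<lambda>i. \<bar>freq N (A i) (B i) (C i) xs - wprob (A i) (B i) (C i)\<bar> > r" for xs]
    show ?thesis by (auto simp: E_def q_def)
  qed
  then have "measure_pmf.prob (data N) {xs. \<exists>i. \<bar>freq N (A i) (B i) (C i) xs - wprob (A i) (B i) (C i)\<bar> > r}
    \<le> (\<Sum>n. measure_pmf.prob (data N) (E n))"
    using measure_pmf.finite_measure_subadditive_countably[of E "data N"] sE by simp
  also have "\<dots> \<le> (\<Sum>n. b * q n)" using Eq sE q by (intro suminf_le) auto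
  also have "\<dots> \<le> b * 1" using q b by (simp add: suminf_mult mult_left_le)
  finally show ?thesis by (simp add: b_def)
qed

end

section \<open>Lexicographic labelling\<close>

text \<open>In any sorted labelling the predecessors of the \<open>i\<close>-th element are exactly
  the elements labelled below \<open>i\<close>. So the number of predecessors determines the
  position, and inverting this rank gives the labelling.\<close>

lemma sorting_bijection_unique:
  fixes R :: "nat \<Rightarrow> nat \<Rightarrow> bool"
  assumes asym: "\<And>i j. R i j \<Longrightarrow> \<not> R j i"
    and trans: "\<And>i j k. R i j \<Longrightarrow> R j k \<Longrightarrow> R i k"
    and total: "\<And>i j. i < J \<Longrightarrow> j < J \<Longrightarrow> i \<noteq> j \<Longrightarrow> R i j \<or> R j i"
  shows "\<exists>\<sigma>. bij_betw \<sigma> {..<J} {..<J} \<and> (\<forall>j<J. \<forall>i<j. R (\<sigma> i) (\<sigma> j)) \<and>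
    (\<forall>\<tau>. bij_betw \<tau> {..<J} {..<J} \<longrightarrow> (\<forall>j<J. \<forall>i<j. R (\<tau> i) (\<tau> j)) \<longrightarrow> (\<forall>i<J. \<tau> i = \<sigma> i))"
proof -
  define rank where "rank k = card {l. l < J \<and> R l k}" for k
  have mono: "rank i < rank j" if "R i j" "i < J" for i j
    unfolding rank_def
  proof (rule psubset_card_mono)
    have "i \<notin> {l. l < J \<and> R l i}" "i \<in> {l. l < J \<and> R l j}" using that asym[of i i] by auto
    moreover have "{l. l < J \<and> R l i} \<subseteq> {l. l < J \<and> R l j}" using trans[OF _ that(1)] by blast
    ultimately show "{l. l < J \<and> R l i} \<subset> {l. l < J \<and> R l j}" by blast
  qed simp
  have bound: "rank k < J" if "k < J" for k
  proof -
    have "rank k < card {..<J}"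
      unfolding rank_def
    proof (rule psubset_card_mono)
      have "k \<notin> {l. l < J \<and> R l k}" "k \<in> {..<J}" using that asym[of k k] by auto
      then show "{l. l < J \<and> R l k} \<subset> {..<J}" by blast
    qed simp
    then show ?thesis by simp
  qed
  have inj: "inj_on rank {..<J}"
  proof (rule inj_onI, rule ccontr)
    fix i j assume ij: "i \<in> {..<J}" "j \<in> {..<J}" "rank i = rank j" "i \<noteq> j"
    then have "R i j \<or> R j i" using total by simp
    then show False using mono[of i j] mono[of j i] ij by auto
  qed
  have "rank ` {..<J} = {..<J}"
    using bound by (intro card_subset_eq) (auto simp: card_image[OF inj])
  with inj have bij: "bij_betw rank {..<J} {..<J}" by (simp add: bij_betw_def)
  define \<sigma> where "\<sigma> = inv_into {..<J} rank"
  have \<sigma>: "bij_betw \<sigma> {..<J} {..<J}" unfolding \<sigma>_def by (rule bij_betw_inv_into[OF bij])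
  have \<sigma>J: "\<sigma> i < J" if "i < J" for i using bij_betwE[OF \<sigma>] that by auto
  have rank_\<sigma>: "rank (\<sigma> i) = i" if "i < J" for i
    using bij_betw_inv_into_right[OF bij] that by (simp add: \<sigma>_def)
  have sorted_\<sigma>: "R (\<sigma> i) (\<sigma> j)" if "j < J" "i < j" for i j
  proof -
    have "\<not> R (\<sigma> j) (\<sigma> i)" using mono[of "\<sigma> j" "\<sigma> i"] rank_\<sigma> \<sigma>J that by auto
    moreover have "\<sigma> i \<noteq> \<sigma> j" using rank_\<sigma>[of i] rank_\<sigma>[of j] that by auto
    ultimately show ?thesis using total[of "\<sigma> i" "\<sigma> j"] \<sigma>J[of i] \<sigma>J[of j] that by simp
  qed
  have unique: "\<tau> i = \<sigma> i"
    if \<tau>: "bij_betw \<tau> {..<J} {..<J}" and sorted: "\<forall>j<J. \<forall>i<j. R (\<tau> i) (\<tau> j)" and i: "i < J" for \<tau> i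
  proof -
    have "{l. l < J \<and> R l (\<tau> i)} = \<tau> ` {..<i}"
    proof (intro equalityI subsetI)
      fix l assume l: "l \<in> {l. l < J \<and> R l (\<tau> i)}"
      then obtain k where k: "k < J" "l = \<tau> k" using \<tau> by (auto simp: bij_betw_def)
      have "R (\<tau> k) (\<tau> i)" using l k by simp
      then have "\<not> R (\<tau> i) (\<tau> k)" "k \<noteq> i" using asym[of "\<tau> k" "\<tau> i"] by auto
      then have "k < i" using sorted k(1) by (cases k i rule: linorder_cases) simp_all
      then show "l \<in> \<tau> ` {..<i}" using k by simp
    next
      fix l assume "l \<in> \<tau> ` {..<i}"
      then obtain k where k: "k < i" "l = \<tau> k" by auto
      moreover have "\<tau> k < J" using bij_betwE[OF \<tau>] k i by simp
      ultimately show "l \<in> {l. l < J \<and> R l (\<tau> i)}" using sorted i by simp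
    qed
    moreover have "inj_on \<tau> {..<i}"
      using i by (intro inj_on_subset[OF bij_betw_imp_inj_on[OF \<tau>]]) auto
    ultimately have "rank (\<tau> i) = rank (\<sigma> i)" by (simp add: rank_def[of "\<tau> i"] card_image rank_\<sigma> i)
    then show ?thesis using bij_betwE[OF \<tau>] \<sigma>J[OF i] i by (auto dest: inj_onD[OF inj])
  qed
  show ?thesis
  proof (intro exI[of _ \<sigma>] conjI allI impI)
    show "bij_betw \<sigma> {..<J} {..<J}" by (rule \<sigma>)
    show "R (\<sigma> i) (\<sigma> j)" if "j < J" "i < j" for i j using that by (rule sorted_\<sigma>)
    show "\<tau> i = \<sigma> i" if "bij_betw \<tau> {..<J} {..<J}" "\<forall>j<J. \<forall>i<j. R (\<tau> i) (\<tau> j)" "i < J" for \<tau> i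
      using that by (rule unique)
  qed
qed

text \<open>Lexicographic order along an enumeration of the integers, where differences up to \<open>d\<close> are
  regarded as ties. For \<open>d\<close> above the estimation error but tending to 0, the order of
  the estimates is eventually that of the true densities.\<close>

definition lex_less :: "real \<Rightarrow> (int \<Rightarrow> real) \<Rightarrow> (int \<Rightarrow> real) \<Rightarrow> bool" where
  "lex_less d g h \<longleftrightarrow> (\<exists>n. (\<forall>m<n. \<bar>g (from_nat m) - h (from_nat m)\<bar> \<le> d) \<and> h (from_nat n) - g (from_nat n) > d)"

lemma lex_less_asym:
  assumes "d \<ge> 0" "lex_less d g h" shows "\<not> lex_less d h g"
proof
  assume "lex_less d h g"
  then obtain n where n: "\<forall>m<n. \<bar>h (from_nat m) - g (from_nat m)\<bar> \<le> d" "g (from_nat n) - h (from_nat n) > d"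
    by (auto simp: lex_less_def)
  obtain k where k: "\<forall>m<k. \<bar>g (from_nat m) - h (from_nat m)\<bar> \<le> d" "h (from_nat k) - g (from_nat k) > d"
    using assms by (auto simp: lex_less_def)
  consider "n < k" | "n = k" | "k < n" by linarith
  then show False
  proof cases
    case 1
    then show False using k(1)[rule_format, of n] n(2) by linarith
  next
    case 2
    then show False using k(2) n(2) assms(1) by simp
  next
    case 3
    then show False using n(1)[rule_format, of k] k(2) by linarith
  qed
qed

text \<open>Stated for tolerance 0, because ties up to a positive tolerance do not compose.
  Uniqueness of the sorted labelling is therefore applied to the true densities.\<close>

lemma lex_less_trans:
  assumes "lex_less 0 f g" "lex_less 0 g h" shows "lex_less 0 f h"
proof -
  obtain n where n: "\<forall>m<n. f (from_nat m) = g (from_nat m)" "f (from_nat n) < g (from_nat n)"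
    using assms by (auto simp: lex_less_def)
  obtain k where k: "\<forall>m<k. g (from_nat m) = h (from_nat m)" "g (from_nat k) < h (from_nat k)"
    using assms by (auto simp: lex_less_def)
  have "\<forall>m<min n k. f (from_nat m) = h (from_nat m)" using n k by auto
  moreover have "f (from_nat (min n k)) < h (from_nat (min n k))"
    using n k by (cases n k rule: linorder_cases) auto
  ultimately show ?thesis unfolding lex_less_def by (intro exI[of _ "min n k"]) auto
qed

lemma lex_less_total:
  assumes "g \<noteq> h" shows "lex_less 0 g h \<or> lex_less 0 h g"
proof -
  obtain x where "g x \<noteq> h x" using assms by auto
  then have ex: "\<exists>n. g (from_nat n) \<noteq> h (from_nat n)" by (metis from_nat_to_nat)
  define n where "n = (LEAST n. g (from_nat n) \<noteq> h (from_nat n))"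
  have "g (from_nat n) \<noteq> h (from_nat n)" "\<forall>m<n. g (from_nat m) = h (from_nat m)"
    using LeastI_ex[OF ex] not_less_Least by (auto simp: n_def)
  then show ?thesis unfolding lex_less_def by (metis abs_zero diff_gt_0_iff_gt diff_self linorder_neqE order_refl)
qed

text \<open>Before the first difference the true values agree, so perturbed ones differ by at most
  \<open>2 * e\<close>, a tie. At the first difference at least \<open>gap - 2 * e\<close> remains,
  which exceeds \<open>d\<close> when \<open>2 * e \<le> d \<le> gap / 3\<close>.\<close>

lemma lex_less_stable:
  assumes "lex_less 0 g h"
  shows "\<exists>d0>0. \<forall>d\<le>d0. \<forall>e g' h'. 2 * e \<le> d \<longrightarrow> (\<forall>x. \<bar>g' x - g x\<bar> \<le> e) \<longrightarrow> (\<forall>x. \<bar>h' x - h x\<bar> \<le> e) \<longrightarrow>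
    lex_less d g' h'"
proof -
  obtain n where n: "\<forall>m<n. g (from_nat m) = h (from_nat m)" "g (from_nat n) < h (from_nat n)"
    using assms by (auto simp: lex_less_def)
  define gap where "gap = h (from_nat n) - g (from_nat n)"
  have gap: "gap > 0" using n by (simp add: gap_def)
  have "lex_less d g' h'"
    if d: "d \<le> gap / 3" "2 * e \<le> d" and e: "\<forall>x. \<bar>g' x - g x\<bar> \<le> e" "\<forall>x. \<bar>h' x - h x\<bar> \<le> e" for d e g' h'
    unfolding lex_less_def
  proof (intro exI[of _ n] conjI allI impI)
    fix m assume "m < n"
    then have "g (from_nat m) = h (from_nat m)" using n by simp
    then show "\<bar>g' (from_nat m) - h' (from_nat m)\<bar> \<le> d"
      using e(1)[rule_format, of "from_nat m"] e(2)[rule_format, of "from_nat m"] d by linarith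
  next
    show "d < h' (from_nat n) - g' (from_nat n)"
    proof -
      have "g' (from_nat n) \<le> g (from_nat n) + e" "h (from_nat n) \<le> h' (from_nat n) + e"
        using e(1)[rule_format, of "from_nat n"] e(2)[rule_format, of "from_nat n"] by linarith+
      then show ?thesis using d gap by (simp add: gap_def)
    qed
  qed
  then show ?thesis using gap by (intro exI[of _ "gap / 3"]) auto
qed

lemma lin_indep_fun_distinct:
  assumes "lin_indep_fun J f" "i < J" "j < J" "i \<noteq> j" shows "f i \<noteq> f j"
proof
  assume eq: "f i = f j"
  define c :: "nat \<Rightarrow> real" where "c k = (if k = i then 1 else 0) - (if k = j then 1 else 0)" for k
  have "(\<Sum>k<J. c k * f k x) = 0" for x
  proof -
    have "(\<Sum>k<J. c k * f k x) = (\<Sum>k<J. (if k = i then f i x else 0) - (if k = j then f j x else 0))"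
      by (intro sum.cong) (auto simp: c_def)
    also have "\<dots> = f i x - f j x" using assms by (simp add: sum_subtractf)
    finally show ?thesis using eq by simp
  qed
  then have "c i = 0" using assms by (auto simp: lin_indep_fun_def)
  then show False using assms by (simp add: c_def)
qed

section \<open>The estimator and its accuracy\<close>

definition candidate :: "nat \<Rightarrow> real \<Rightarrow> real \<Rightarrow> nat \<Rightarrow> int list \<Rightarrow> (nat \<Rightarrow> nat \<Rightarrow> real) \<Rightarrow> (nat \<Rightarrow> real)
    \<Rightarrow> (nat \<Rightarrow> int \<Rightarrow> real) \<Rightarrow> (nat \<Rightarrow> nat) \<Rightarrow> bool" where
  "candidate J d r N xs Q p f \<sigma> \<longleftrightarrow> A2' J Q p \<and> A3 J f \<and> bij_betw \<sigma> {..<J} {..<J} \<and>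
    (\<forall>j<J. \<forall>i<j. lex_less d (f (\<sigma> i)) (f (\<sigma> j))) \<and>
    (\<forall>x y z. \<bar>freq N {x} {y} {z} xs - trilinear J Q p (\<lambda>i. f i x) (\<lambda>i. f i y) (\<lambda>i. f i z)\<bar> \<le> r) \<and>
    (\<forall>x z. \<bar>freq N {x} UNIV {z} xs - trilinear J Q p (\<lambda>i. f i x) (\<lambda>i. 1) (\<lambda>i. f i z)\<bar> \<le> r)"

text \<open>The choice is made for the whole sorted family before \<open>j\<close> is applied, so
  all estimates stem from one candidate. If no candidate exists the value is arbitrary; this can
  happen only when the frequencies are inaccurate.\<close>

definition emission_estimate :: "nat \<Rightarrow> real \<Rightarrow> real \<Rightarrow> nat \<Rightarrow> int list \<Rightarrow> nat \<Rightarrow> int \<Rightarrow> real" where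
  "emission_estimate J d r N xs j =
    (SOME g. \<exists>Q p f \<sigma>. candidate J d r N xs Q p f \<sigma> \<and> g = (\<lambda>j. f (\<sigma> j))) j"

context hmm
begin

lemma wprob_singletons:
  "wprob {x} {y} {z} = trilinear J Q p (\<lambda>i. f i x) (\<lambda>i. f i y) (\<lambda>i. f i z)"
  by (simp add: wprob_def trilinear_def emass_singleton)

lemma wprob_singletons_UNIV:
  "wprob {x} UNIV {z} = trilinear J Q p (\<lambda>i. f i x) (\<lambda>i. 1) (\<lambda>i. f i z)"
  by (simp add: wprob_def trilinear_def emass_singleton emass_UNIV)

lemma prob_inaccurate:
  "\<exists>K\<ge>0. \<forall>N r. N \<ge> 3 \<longrightarrow> r > 0 \<longrightarrow> measure_pmf.prob (data N)
    {xs. (\<exists>x y z. \<bar>freq N {x} {y} {z} xs - wprob {x} {y} {z}\<bar> > r)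
      \<or> (\<exists>x z. \<bar>freq N {x} UNIV {z} xs - wprob {x} UNIV {z}\<bar> > r)} \<le> K / (real (N - 2) * r\<^sup>2)"
proof -
  obtain K where K: "K \<ge> 0" "\<And>A B C N r. N \<ge> 3 \<Longrightarrow> r > 0 \<Longrightarrow>
      measure_pmf.prob (data N) {xs. \<bar>freq N A B C xs - wprob A B C\<bar> > r} \<le> K / (real (N - 2) * r\<^sup>2) * wprob A B C"
    using prob_freq_deviation by blast
  have 1: "measure_pmf.prob (data N) {xs. \<exists>x y z. \<bar>freq N {x} {y} {z} xs - wprob {x} {y} {z}\<bar> > r}
    \<le> K / (real (N - 2) * r\<^sup>2)" if "N \<ge> 3" "r > 0" for N r
    using prob_uniform_freq_deviation[OF K _ _ _ that,
        of "\<lambda>(x, y, z). {x}" "\<lambda>(x, y, z). {y}" "\<lambda>(x, y, z). {z}"]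
    by (simp add: window_def finite_prod split_paired_all)
  have 2: "measure_pmf.prob (data N) {xs. \<exists>x z. \<bar>freq N {x} UNIV {z} xs - wprob {x} UNIV {z}\<bar> > r}
    \<le> K / (real (N - 2) * r\<^sup>2)" if "N \<ge> 3" "r > 0" for N r
    using prob_uniform_freq_deviation[OF K _ _ _ that,
        of "\<lambda>(x, z). {x}" "\<lambda>(x, z). UNIV" "\<lambda>(x, z). {z}"]
    by (simp add: window_def finite_prod split_paired_all)
  have "measure_pmf.prob (data N)
    {xs. (\<exists>x y z. \<bar>freq N {x} {y} {z} xs - wprob {x} {y} {z}\<bar> > r)
      \<or> (\<exists>x z. \<bar>freq N {x} UNIV {z} xs - wprob {x} UNIV {z}\<bar> > r)} \<le> (K + K) / (real (N - 2) * r\<^sup>2)"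
    if "N \<ge> 3" "r > 0" for N r
    unfolding Collect_disj_eq add_divide_distrib
    by (intro order_trans[OF measure_Un_le] add_mono 1 2 that) auto
  then show ?thesis using K by (intro exI[of _ "K + K"]) simp
qed

lemma emission_order:
  "\<exists>\<sigma>. bij_betw \<sigma> {..<J} {..<J} \<and> (\<forall>j<J. \<forall>i<j. lex_less 0 (f (\<sigma> i)) (f (\<sigma> j))) \<and>
    (\<forall>\<tau>. bij_betw \<tau> {..<J} {..<J} \<longrightarrow> (\<forall>j<J. \<forall>i<j. lex_less 0 (f (\<tau> i)) (f (\<tau> j))) \<longrightarrow> (\<forall>i<J. \<tau> i = \<sigma> i))"
proof (rule sorting_bijection_unique)
  show "lex_less 0 (f i) (f j) \<or> lex_less 0 (f j) (f i)" if "i < J" "j < J" "i \<noteq> j" for i j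
    using lex_less_total lin_indep_fun_distinct[OF _ that] A3 by (auto simp: A3_def)
  show "\<not> lex_less 0 (f j) (f i)" if "lex_less 0 (f i) (f j)" for i j
    using lex_less_asym[OF order_refl that] .
  show "lex_less 0 (f i) (f k)" if "lex_less 0 (f i) (f j)" "lex_less 0 (f j) (f k)" for i j k
    using lex_less_trans[OF that] .
qed

text \<open>Each pair has its own threshold; finiteness of the set of pairs gives a common one,
  expressed through the filter \<open>at_right 0\<close>.\<close>

lemma emission_order_stable:
  "\<exists>d0>0. \<forall>i<J. \<forall>j<J. lex_less 0 (f i) (f j) \<longrightarrow> (\<forall>d\<le>d0. \<forall>e g' h'. 2 * e \<le> d \<longrightarrow>
    (\<forall>x. \<bar>g' x - f i x\<bar> \<le> e) \<longrightarrow> (\<forall>x. \<bar>h' x - f j x\<bar> \<le> e) \<longrightarrow> lex_less d g' h')"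
proof -
  define P where "P d0 i j \<longleftrightarrow> (lex_less 0 (f i) (f j) \<longrightarrow> (\<forall>d\<le>d0. \<forall>e g' h'. 2 * e \<le> d \<longrightarrow>
    (\<forall>x. \<bar>g' x - f i x\<bar> \<le> e) \<longrightarrow> (\<forall>x. \<bar>h' x - f j x\<bar> \<le> e) \<longrightarrow> lex_less d g' h'))" for d0 i j
  have mono: "P d0 i j" if "P d1 i j" "d0 \<le> d1" for d0 d1 i j
    unfolding P_def
  proof (intro impI allI)
    fix d e g' h' assume "lex_less 0 (f i) (f j)" "d \<le> d0" "2 * e \<le> d"
      "\<forall>x. \<bar>g' x - f i x\<bar> \<le> e" "\<forall>x. \<bar>h' x - f j x\<bar> \<le> e"
    then show "lex_less d g' h'" using that(1)[unfolded P_def, rule_format, of d e g' h'] that(2) by simp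
  qed
  have ev: "\<forall>\<^sub>F d0 in at_right 0. P d0 i j" for i j
  proof -
    have "\<exists>d1>0. P d1 i j"
    proof (cases "lex_less 0 (f i) (f j)")
      case True
      then show ?thesis unfolding P_def using lex_less_stable[OF True] by simp
    next
      case False
      then show ?thesis unfolding P_def by (intro exI[of _ 1]) simp
    qed
    then obtain d1 where d1: "d1 > 0" "P d1 i j" by blast
    then show ?thesis unfolding eventually_at_right_field
      using mono by (intro exI[of _ d1]) (simp add: less_imp_le)
  qed
  have "\<forall>\<^sub>F d0 in at_right 0. \<forall>i\<in>{..<J}. \<forall>j\<in>{..<J}. P d0 i j"
    by (intro eventually_ball_finite ballI ev) simp_all
  then have "\<forall>\<^sub>F d0 in at_right 0. d0 > 0 \<and> (\<forall>i\<in>{..<J}. \<forall>j\<in>{..<J}. P d0 i j)"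
    by (intro eventually_conj eventually_at_right_less)
  then obtain d0 where "d0 > 0" "\<forall>i\<in>{..<J}. \<forall>j\<in>{..<J}. P d0 i j"
    using eventually_happens[of _ "at_right (0 :: real)"] trivial_limit_at_right_real by blast
  then show ?thesis unfolding P_def[symmetric] by (intro exI[of _ d0]) auto
qed

text \<open>With accurate frequencies the true parameter is itself a candidate, so the choice
  succeeds, and any chosen candidate has laws within \<open>2 * r\<close> of the true ones.\<close>

lemma emission_estimate_accurate:
  "\<exists>C d0 \<sigma>. C > 0 \<and> d0 > 0 \<and> bij_betw \<sigma> {..<J} {..<J} \<and> (\<forall>d r N xs.
    0 \<le> d \<longrightarrow> d \<le> d0 \<longrightarrow> r \<le> d0 \<longrightarrow> C * r \<le> d \<longrightarrow>
    (\<forall>x y z. \<bar>freq N {x} {y} {z} xs - wprob {x} {y} {z}\<bar> \<le> r) \<longrightarrow>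
    (\<forall>x z. \<bar>freq N {x} UNIV {z} xs - wprob {x} UNIV {z}\<bar> \<le> r) \<longrightarrow>
    (\<forall>j<J. \<forall>x. \<bar>emission_estimate J d r N xs j x - f (\<sigma> j) x\<bar> \<le> C * r))"
proof -
  obtain \<sigma> where \<sigma>: "bij_betw \<sigma> {..<J} {..<J}" and \<sigma>_sorted: "\<forall>j<J. \<forall>i<j. lex_less 0 (f (\<sigma> i)) (f (\<sigma> j))"
    and \<sigma>_unique: "\<And>\<tau>. bij_betw \<tau> {..<J} {..<J} \<Longrightarrow> \<forall>j<J. \<forall>i<j. lex_less 0 (f (\<tau> i)) (f (\<tau> j)) \<Longrightarrow> \<forall>i<J. \<tau> i = \<sigma> i"
    using emission_order by blast
  obtain d1 where d1: "d1 > 0" and stable: "\<forall>i<J. \<forall>j<J. lex_less 0 (f i) (f j) \<longrightarrow>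
    (\<forall>d\<le>d1. \<forall>e g' h'. 2 * e \<le> d \<longrightarrow> (\<forall>x. \<bar>g' x - f i x\<bar> \<le> e) \<longrightarrow>
      (\<forall>x. \<bar>h' x - f j x\<bar> \<le> e) \<longrightarrow> lex_less d g' h')"
    using emission_order_stable by (elim exE conjE that)
  obtain C e0 where C: "C > 0" and e0: "e0 > 0" and inverse: "\<forall>Q' p' f' r. A2' J Q' p' \<longrightarrow> A3 J f' \<longrightarrow> r \<le> e0 \<longrightarrow>
    (\<forall>x y z. \<bar>trilinear J Q' p' (\<lambda>i. f' i x) (\<lambda>i. f' i y) (\<lambda>i. f' i z)
       - trilinear J Q p (\<lambda>i. f i x) (\<lambda>i. f i y) (\<lambda>i. f i z)\<bar> \<le> r) \<longrightarrow>
    (\<forall>x z. \<bar>trilinear J Q' p' (\<lambda>i. f' i x) (\<lambda>i. 1) (\<lambda>i. f' i z)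
       - trilinear J Q p (\<lambda>i. f i x) (\<lambda>i. 1) (\<lambda>i. f i z)\<bar> \<le> r) \<longrightarrow>
    (\<exists>\<tau>. bij_betw \<tau> {..<J} {..<J} \<and> (\<forall>j<J. \<forall>y. \<bar>f' j y - f (\<tau> j) y\<bar> \<le> C * r))"
    using inverse_stability[OF A2 A3] by (elim exE conjE that)
  have \<sigma>J: "\<sigma> i < J" if "i < J" for i using bij_betwE[OF \<sigma>] that by auto
  show ?thesis
  \<comment> \<open>Inverse stability is used with \<open>2 * r\<close>, hence
    \<open>e0 / 2\<close>, and yields the error \<open>C * (2 * r)\<close>. Stability of the order
    asks for twice this error to be at most \<open>d\<close>, hence \<open>4 * C\<close>.\<close>
  proof (rule exI[of _ "4 * C"], rule exI[of _ "min d1 (e0 / 2)"], rule exI[of _ \<sigma>], intro conjI allI impI)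
    fix d r N xs j x
    assume d: "0 \<le> d" "d \<le> min d1 (e0 / 2)" and r: "r \<le> min d1 (e0 / 2)" and rd: "4 * C * r \<le> d"
      and f3: "\<forall>x y z. \<bar>freq N {x} {y} {z} xs - wprob {x} {y} {z}\<bar> \<le> r"
      and f2: "\<forall>x z. \<bar>freq N {x} UNIV {z} xs - wprob {x} UNIV {z}\<bar> \<le> r" and j: "j < J"
    have r0: "r \<ge> 0" using f2 by (meson abs_ge_zero order_trans)
    define ok where "ok g \<longleftrightarrow> (\<exists>Q p f \<sigma>. candidate J d r N xs Q p f \<sigma> \<and> g = (\<lambda>j. f (\<sigma> j)))" for g
    have "candidate J d r N xs Q p f \<sigma>"
      unfolding candidate_def
    proof (intro conjI allI impI)
      fix i j assume "j < J" "i < j"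
      \<comment> \<open>Stability with error 0: the true densities remain sorted when the tolerance
        is raised to \<open>d\<close>.\<close>
      then show "lex_less d (f (\<sigma> i)) (f (\<sigma> j))"
        using d \<sigma>_sorted \<sigma>J by (intro stable[rule_format, of "\<sigma> i" "\<sigma> j" d 0]) auto
    qed (use A2 A3 \<sigma> f2 f3 in \<open>simp_all add: wprob_singletons wprob_singletons_UNIV\<close>)
    then have "ok (\<lambda>j. f (\<sigma> j))" unfolding ok_def by blast
    then have "ok (emission_estimate J d r N xs)"
      unfolding emission_estimate_def[abs_def] ok_def[symmetric] by (rule someI[of ok])
    then obtain Q' p' f' \<sigma>' where cand: "candidate J d r N xs Q' p' f' \<sigma>'"
      and est: "emission_estimate J d r N xs = (\<lambda>j. f' (\<sigma>' j))" by (auto simp: ok_def)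
    have \<sigma>': "bij_betw \<sigma>' {..<J} {..<J}" and sorted: "\<And>i j. j < J \<Longrightarrow> i < j \<Longrightarrow> lex_less d (f' (\<sigma>' i)) (f' (\<sigma>' j))"
      using cand by (auto simp: candidate_def)
    have "\<exists>\<tau>. bij_betw \<tau> {..<J} {..<J} \<and> (\<forall>j<J. \<forall>y. \<bar>f' j y - f (\<tau> j) y\<bar> \<le> C * (2 * r))"
    proof (rule inverse[THEN spec, THEN spec, THEN spec, THEN spec, THEN mp, THEN mp, THEN mp, THEN mp, THEN mp])
      show "\<forall>x y z. \<bar>trilinear J Q' p' (\<lambda>i. f' i x) (\<lambda>i. f' i y) (\<lambda>i. f' i z)
       - trilinear J Q p (\<lambda>i. f i x) (\<lambda>i. f i y) (\<lambda>i. f i z)\<bar> \<le> 2 * r"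
      proof (intro allI)
        fix x y z
        have "\<bar>freq N {x} {y} {z} xs - trilinear J Q' p' (\<lambda>i. f' i x) (\<lambda>i. f' i y) (\<lambda>i. f' i z)\<bar> \<le> r"
          using cand by (simp add: candidate_def)
        with f3[rule_format, of x y z]
        show "\<bar>trilinear J Q' p' (\<lambda>i. f' i x) (\<lambda>i. f' i y) (\<lambda>i. f' i z)
          - trilinear J Q p (\<lambda>i. f i x) (\<lambda>i. f i y) (\<lambda>i. f i z)\<bar> \<le> 2 * r"
          unfolding wprob_singletons by linarith
      qed
      show "\<forall>x z. \<bar>trilinear J Q' p' (\<lambda>i. f' i x) (\<lambda>i. 1) (\<lambda>i. f' i z)
       - trilinear J Q p (\<lambda>i. f i x) (\<lambda>i. 1) (\<lambda>i. f i z)\<bar> \<le> 2 * r"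
      proof (intro allI)
        fix x z
        have "\<bar>freq N {x} UNIV {z} xs - trilinear J Q' p' (\<lambda>i. f' i x) (\<lambda>i. 1) (\<lambda>i. f' i z)\<bar> \<le> r"
          using cand by (simp add: candidate_def)
        with f2[rule_format, of x z]
        show "\<bar>trilinear J Q' p' (\<lambda>i. f' i x) (\<lambda>i. 1) (\<lambda>i. f' i z)
          - trilinear J Q p (\<lambda>i. f i x) (\<lambda>i. 1) (\<lambda>i. f i z)\<bar> \<le> 2 * r"
          unfolding wprob_singletons_UNIV by linarith
      qed
    qed (use cand r in \<open>auto simp: candidate_def\<close>)
    then obtain \<tau> where \<tau>: "bij_betw \<tau> {..<J} {..<J}"
      and close: "\<And>j y. j < J \<Longrightarrow> \<bar>f' j y - f (\<tau> j) y\<bar> \<le> C * (2 * r)" by blast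
    \<comment> \<open>The true label of the \<open>j\<close>-th sorted estimate. It must sort the
      true densities, since a reversed pair would by stability also be reversed among the estimates;
      uniqueness then identifies it with \<open>\<sigma>\<close>, which does not depend on the
      data.\<close>
    define \<rho> where "\<rho> = \<tau> \<circ> \<sigma>'"
    have \<rho>: "bij_betw \<rho> {..<J} {..<J}" unfolding \<rho>_def by (rule bij_betw_trans[OF \<sigma>' \<tau>])
    have \<rho>J: "\<rho> i < J" if "i < J" for i using bij_betwE[OF \<rho>] that by auto
    have close\<rho>: "\<bar>f' (\<sigma>' j) y - f (\<rho> j) y\<bar> \<le> C * (2 * r)" if "j < J" for j y
      using close[of "\<sigma>' j"] bij_betwE[OF \<sigma>'] that by (simp add: \<rho>_def)
    have "lex_less 0 (f (\<rho> i)) (f (\<rho> j))" if ij: "j < J" "i < j" for i j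
    proof (rule ccontr)
      assume "\<not> lex_less 0 (f (\<rho> i)) (f (\<rho> j))"
      moreover have "\<rho> i \<noteq> \<rho> j" using \<rho> ij by (auto simp: bij_betw_def inj_on_def)
      then have "f (\<rho> i) \<noteq> f (\<rho> j)"
        using lin_indep_fun_distinct A3 \<rho>J ij by (auto simp: A3_def)
      ultimately have "lex_less 0 (f (\<rho> j)) (f (\<rho> i))" using lex_less_total by blast
      then have "lex_less d (f' (\<sigma>' j)) (f' (\<sigma>' i))"
        using d rd close\<rho> \<rho>J ij by (intro stable[rule_format, of "\<rho> j" "\<rho> i" d "C * (2 * r)"]) auto
      then show False using lex_less_asym[OF d(1) sorted[OF ij]] by simp
    qed
    then have "\<rho> j = \<sigma> j" using \<sigma>_unique[OF \<rho>] j by blast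
    moreover have "C * (2 * r) \<le> 4 * C * r" using C r0 by simp
    ultimately show "\<bar>emission_estimate J d r N xs j x - f (\<sigma> j) x\<bar> \<le> 4 * C * r"
      using close\<rho>[OF j, of x] est by simp
  qed (use C d1 e0 \<sigma> in auto)
qed

end

section \<open>Choice of rates and the convergence in probability\<close>

theorem theorem4:
  fixes J :: nat and M :: "nat \<Rightarrow> real"
  assumes "J \<ge> 2"
    and "filterlim M at_top sequentially"
  shows "\<exists>fhat :: nat \<Rightarrow> int list \<Rightarrow> nat \<Rightarrow> int \<Rightarrow> real.
     \<forall>Q p f. A2' J Q p \<and> A3 J f \<longrightarrow>
       (\<exists>\<tau>. \<tau> permutes {..<J} \<and>
          (\<forall>j<J. (\<lambda>N. hmm_P J Q p f N
                 (\<lambda>xs. sup_norm (\<lambda>x. fhat N xs j x - f (\<tau> j) x) \<ge> ereal (M N / sqrt (real N))))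
               \<longlonglongrightarrow> 0))"
proof -
  \<comment> \<open>Capping \<open>M N\<close> at the fourth root of \<open>N\<close> makes the
    tolerance \<open>d\<close> tend to 0 however fast \<open>M\<close> grows. The radius
    \<open>r\<close> uses the square root of \<open>a\<close>: it still exceeds the order
    \<open>1 / sqrt N\<close>, while any constant multiple of it is eventually below
    \<open>d\<close>.\<close>
  define a where "a N = min (M N) (sqrt (sqrt (real N)))" for N
  define r where "r N = sqrt (a N) / sqrt (real N)" for N
  define d where "d N = a N / sqrt (real N)" for N
  have "filterlim (\<lambda>N. sqrt (sqrt (real N))) at_top sequentially" by real_asymp
  then have a: "filterlim a at_top sequentially"
    using assms(2) unfolding a_def filterlim_at_top by (simp add: eventually_conj_iff)
  have a_ge: "\<forall>\<^sub>F N in sequentially. a N \<ge> b" for b using a by (simp add: filterlim_at_top)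
  have "(\<lambda>N. sqrt (sqrt (real N)) / sqrt (real N)) \<longlonglongrightarrow> 0" by real_asymp
  then have d: "d \<longlonglongrightarrow> 0"
  proof (rule Lim_null_comparison[rotated])
    show "\<forall>\<^sub>F N in sequentially. norm (d N) \<le> sqrt (sqrt (real N)) / sqrt (real N)"
      using a_ge[of 0] by eventually_elim (auto simp: d_def a_def divide_right_mono)
  qed
  show ?thesis
  \<comment> \<open>The estimator is fixed before the parameter is introduced: it involves only
    \<open>J\<close>, the rates and the data.\<close>
  proof (intro exI[of _ "\<lambda>N. emission_estimate J (d N) (r N) N"] allI impI)
    fix Q p f assume "A2' J Q p \<and> A3 J f"
    then interpret hmm J Q p f by unfold_locales auto
    obtain C d0 \<sigma> where C: "C > 0" and d0: "d0 > 0" and \<sigma>: "bij_betw \<sigma> {..<J} {..<J}"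
      and accurate: "\<forall>d r N xs. 0 \<le> d \<longrightarrow> d \<le> d0 \<longrightarrow> r \<le> d0 \<longrightarrow> C * r \<le> d \<longrightarrow>
        (\<forall>x y z. \<bar>freq N {x} {y} {z} xs - wprob {x} {y} {z}\<bar> \<le> r) \<longrightarrow>
        (\<forall>x z. \<bar>freq N {x} UNIV {z} xs - wprob {x} UNIV {z}\<bar> \<le> r) \<longrightarrow>
        (\<forall>j<J. \<forall>x. \<bar>emission_estimate J d r N xs j x - f (\<sigma> j) x\<bar> \<le> C * r)"
      using emission_estimate_accurate by (elim exE conjE that)
    obtain K where K: "K \<ge> 0" and inaccurate: "\<forall>N r. N \<ge> 3 \<longrightarrow> r > 0 \<longrightarrow> measure_pmf.prob (data N)
      {xs. (\<exists>x y z. \<bar>freq N {x} {y} {z} xs - wprob {x} {y} {z}\<bar> > r)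
        \<or> (\<exists>x z. \<bar>freq N {x} UNIV {z} xs - wprob {x} UNIV {z}\<bar> > r)} \<le> K / (real (N - 2) * r\<^sup>2)"
      using prob_inaccurate by (elim exE conjE that)
    \<comment> \<open>\<open>\<sigma>\<close> is controlled only below \<open>J\<close>;
      \<open>permutes\<close> asks for the identity elsewhere.\<close>
    define \<tau> where "\<tau> j = (if j < J then \<sigma> j else j)" for j
    have "bij_betw \<tau> {..<J} {..<J}" using \<sigma> by (subst bij_betw_cong[of _ _ \<sigma>]) (auto simp: \<tau>_def)
    then have \<tau>: "\<tau> permutes {..<J}" by (rule bij_imp_permutes) (simp add: \<tau>_def)
    have lim: "(\<lambda>N. hmm_P J Q p f N (\<lambda>xs. sup_norm (\<lambda>x. emission_estimate J (d N) (r N) N xs j x - f (\<tau> j) x)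
        \<ge> ereal (M N / sqrt (real N)))) \<longlonglongrightarrow> 0" if j: "j < J" for j
    proof (rule Lim_null_comparison)
      show "(\<lambda>N. 3 * K / a N) \<longlonglongrightarrow> 0"
        using a by (intro tendsto_divide_0[OF tendsto_const] filterlim_at_top_imp_at_infinity)
      have "\<forall>\<^sub>F N in sequentially. d N < d0" using order_tendstoD(2)[OF d d0] .
      then show "\<forall>\<^sub>F N in sequentially. norm (hmm_P J Q p f N (\<lambda>xs.
        sup_norm (\<lambda>x. emission_estimate J (d N) (r N) N xs j x - f (\<tau> j) x) \<ge> ereal (M N / sqrt (real N))))
        \<le> 3 * K / a N"
        \<comment> \<open>The bound \<open>(C + 1)\<^sup>2\<close> gives
          \<open>C * sqrt (a N) < a N\<close>, so the estimation error is strictly below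
          \<open>d N\<close>, hence below the target rate. The bound 1 gives
          \<open>r N \<le> d N\<close>, so \<open>d N < d0\<close> also controls the radius.\<close>
        using a_ge[of "max 1 ((C + 1)\<^sup>2)"] eventually_ge_at_top[of 3]
      proof eventually_elim
        case (elim N)
        have N: "N \<ge> 3" and a1: "a N \<ge> 1" and aC: "a N \<ge> (C + 1)\<^sup>2" using elim by auto
        have sC: "sqrt (a N) \<ge> C + 1" using aC C by (intro real_le_rsqrt) 
        have sa: "sqrt (a N) * sqrt (a N) = a N" "sqrt (a N) \<ge> 1" using a1 by auto
        have Ca: "C * sqrt (a N) < a N"
        proof -
          have "C * sqrt (a N) < (C + 1) * sqrt (a N)" using sa by simp
          also have "\<dots> \<le> sqrt (a N) * sqrt (a N)" using sC sa by (intro mult_right_mono) auto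
          finally show ?thesis using sa by simp
        qed
        have sN: "sqrt (real N) > 0" using N by simp
        have Cr: "C * r N < d N" using Ca sN by (simp add: r_def d_def divide_strict_right_mono)
        have rd: "r N \<le> d N" unfolding r_def d_def
          using sa sN mult_left_mono[of 1 "sqrt (a N)" "sqrt (a N)"] by (intro divide_right_mono) auto
        have dM: "d N \<le> M N / sqrt (real N)" unfolding d_def a_def using sN by (intro divide_right_mono) auto
        have r0: "r N > 0" using a1 sN by (simp add: r_def)
        define Bad where "Bad = {xs. (\<exists>x y z. \<bar>freq N {x} {y} {z} xs - wprob {x} {y} {z}\<bar> > r N)
          \<or> (\<exists>x z. \<bar>freq N {x} UNIV {z} xs - wprob {x} UNIV {z}\<bar> > r N)}"
        let ?E = "\<lambda>xs. sup_norm (\<lambda>x. emission_estimate J (d N) (r N) N xs j x - f (\<tau> j) x) \<ge> ereal (M N / sqrt (real N))"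
        have sub: "{xs. ?E xs} \<subseteq> Bad"
        proof (rule subsetI, rule ccontr)
          fix xs assume E: "xs \<in> {xs. ?E xs}" and "xs \<notin> Bad"
          then have "\<bar>emission_estimate J (d N) (r N) N xs j x - f (\<tau> j) x\<bar> \<le> C * r N" for x
            using accurate[rule_format, of "d N" "r N" N xs j x] j elim rd Cr r0 C by (auto simp: Bad_def not_less \<tau>_def)
          then have "sup_norm (\<lambda>x. emission_estimate J (d N) (r N) N xs j x - f (\<tau> j) x) \<le> ereal (C * r N)"
            unfolding sup_norm_def by (intro SUP_least) simp
          also have "\<dots> < ereal (M N / sqrt (real N))" using Cr dM by simp
          finally show False using E by simp
        qed
        have "norm (hmm_P J Q p f N ?E) = measure_pmf.prob (data N) {xs. ?E xs}" by (simp add: prob_data[symmetric])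
        also have "\<dots> \<le> measure_pmf.prob (data N) Bad" by (intro measure_pmf.finite_measure_mono sub) simp
        also have "\<dots> \<le> K / (real (N - 2) * (r N)\<^sup>2)" unfolding Bad_def using inaccurate N r0 by blast
        also have "\<dots> \<le> K / (a N / 3)"
        proof (intro divide_left_mono)
          \<comment> \<open>\<open>N - 2\<close> is at least \<open>N / 3\<close> for
            \<open>N \<ge> 3\<close>, and the squared radius is \<open>a N / N\<close>; this is the
            source of the factor 3.\<close>
          have "a N * (real N * (1 / 3)) \<le> a N * real (N - 2)" using a1 N by (intro mult_left_mono) auto
          then show "a N / 3 \<le> real (N - 2) * (r N)\<^sup>2"
            using a1 N by (simp add: r_def power_divide field_simps)
        qed (use K a1 N r0 in auto)
        finally show ?case by (simp add: mult.commute)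
      qed
    qed
    show "\<exists>\<tau>. \<tau> permutes {..<J} \<and> (\<forall>j<J. (\<lambda>N. hmm_P J Q p f N (\<lambda>xs.
      sup_norm (\<lambda>x. emission_estimate J (d N) (r N) N xs j x - f (\<tau> j) x) \<ge> ereal (M N / sqrt (real N)))) \<longlonglongrightarrow> 0)"
      using \<tau> lim by blast
  qed
qed

end
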